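(* Let $r\ge1$, $M\ge1$ be integers and $s=\lceil r/2\rceil$. For real $q\in[M/r,M]$ let $c(q)=\lfloor M/q\rfloor$ and $$\Phi_{r,M}(\lambda,q)=\frac1{1-(r+1)\lambda}+\frac1{1-r\lambda}+\frac{M-c(q)q}{1-(c(q)+1)\lambda}+\frac{q(c(q)+1)-M}{1-c(q)\lambda}.$$ Then for every $q\in[M/r,M]$ the equation $\Phi_{r,M}(\lambda,q)=0$ has a unique solution $\Sigma_{r,M}(q)\in\left(\frac1{r+1},\frac1r\right)$. The function $q\mapsto\Sigma_{r,M}(q)$ is continuous on $[M/r,M]$, piecewise $C^1$, strictly increasing on $[M/r,M/s]$ and strictly decreasing on $[M/s,M]$. Consequently, with $q_-=\max\{1,\lfloor M/s\rfloor\}$, $q_+=\lceil M/s\rceil$, $M=q_-c_-+t_-$ ($0\le t_-<q_-$) and $M=q_+c_++t_+$ ($0\le t_+<q_+$), $$\max_{\lceil M/r\rceil\le q\le M}\lambda_2(\mathrm{AS}(r,q+2,c,t))=\max\{\lambda_2(\mathrm{AS}(r,q_-+2,c_-,t_-)),\ \lambda_2(\mathrm{AS}(r,q_++2,c_+,t_+))\},$$ where on the left, for each integer $q$, $M=qc+t$ with $0\le t<q$.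
   Context: For integers $b\ge2$ and $\ell_1,\dots,\ell_b\ge1$, the spider $S(\ell_1,\dots,\ell_b)$ is the tree obtained by taking $b$ paths of lengths $\ell_1,\dots,\ell_b$ and identifying one endpoint of each into a single common vertex, the paths being otherwise disjoint. For integers $r\ge1$, $b\ge2$, $c\ge1$, $0\le t\le b-2$, $\mathrm{AS}(r,b,c,t)$ is the spider with branches of lengths $r+1$, $r$, $t$ branches of length $c+1$ and $b-2-t$ branches of length $c$. For a tree $T=(V,E)$ with leaf set $\delta\Omega$, the harmonic extension $\widehat g$ of $g\colon\delta\Omega\to\mathbb R$ is the unique function on $V$ equal to $g$ on $\delta\Omega$ with $\sum_{w\sim v}(\widehat g(v)-\widehat g(w))=0$ at every non-leaf $v$, and $\lambda_2(T)=\min\{\sum_{xy\in E}(\widehat g(x)-\widehat g(y))^2/\sum_\omega g(\omega)^2: g\ne0,\ \sum_\omega g(\omega)=0\}$ is the first nonzero Steklov eigenvalue. *)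

theory Defs
  imports "HOL-Analysis.Analysis"
begin

type_synonym 'v graph = "'v set \<times> 'v set set"

definition verts :: "'v graph \<Rightarrow> 'v set" where
  "verts G = fst G"

definition edges :: "'v graph \<Rightarrow> 'v set set" where
  "edges G = snd G"

definition nbrs :: "'v graph \<Rightarrow> 'v \<Rightarrow> 'v set" where
  "nbrs G v = {w \<in> verts G. {v, w} \<in> edges G}"

definition leaves :: "'v graph \<Rightarrow> 'v set" where
  "leaves G = {v \<in> verts G. card (nbrs G v) = 1}"

(* Restricting to extensional functions makes the extension unique as a HOL function. *)
definition harmonic_ext :: "'v graph \<Rightarrow> ('v \<Rightarrow> real) \<Rightarrow> 'v \<Rightarrow> real" where
  "harmonic_ext G g = (THE h. h \<in> extensional (verts G) \<and>
      (\<forall>\<omega>\<in>leaves G. h \<omega> = g \<omega>) \<and>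
      (\<forall>v\<in>verts G - leaves G. (\<Sum>w\<in>nbrs G v. h v - h w) = 0))"

(* The factor 1/2 compensates for the double sum visiting each edge once in each direction. *)
definition energy :: "'v graph \<Rightarrow> ('v \<Rightarrow> real) \<Rightarrow> real" where
  "energy G h = (\<Sum>x\<in>verts G. \<Sum>y\<in>nbrs G x. (h x - h y)\<^sup>2) / 2"

(* Only the values of g on the leaves matter, so "g is nonzero" means nonzero at some leaf.
   LEAST is the minimum of the set of quotients. *)
definition steklov_lambda2 :: "'v graph \<Rightarrow> real" where
  "steklov_lambda2 G = (LEAST \<rho>. \<rho> \<in>
      {energy G (harmonic_ext G g) / (\<Sum>\<omega>\<in>leaves G. (g \<omega>)\<^sup>2) | g.
         (\<exists>\<omega>\<in>leaves G. g \<omega> \<noteq> 0) \<and> (\<Sum>\<omega>\<in>leaves G. g \<omega>) = 0})"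

(* The vertex at distance j from the centre on branch i; the starting points (j = 0) of all
   branches are identified with the centre (0, 0). *)
definition spider_vert :: "nat \<Rightarrow> nat \<Rightarrow> nat \<times> nat" where
  "spider_vert i j = (if j = 0 then (0, 0) else (i, j))"

definition spider :: "nat list \<Rightarrow> (nat \<times> nat) graph" where
  "spider ls =
     ({spider_vert i j | i j. i < length ls \<and> j \<le> ls ! i},
      {{spider_vert i j, spider_vert i (Suc j)} | i j. i < length ls \<and> j < ls ! i})"

(* Intended for r \<ge> 1, b \<ge> 2, c \<ge> 1 and t \<le> b - 2. *)
definition AS :: "nat \<Rightarrow> nat \<Rightarrow> nat \<Rightarrow> nat \<Rightarrow> (nat \<times> nat) graph" where
  "AS r b c t = spider ([r + 1, r] @ replicate t (c + 1) @ replicate (b - 2 - t) c)"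

(* For M/r \<le> q \<le> M and 1/(r+1) < \<lambda> < 1/r none of the denominators vanishes. *)
definition Phi :: "nat \<Rightarrow> nat \<Rightarrow> real \<Rightarrow> real \<Rightarrow> real" where
  "Phi r M lam q =
     (let c = real_of_int \<lfloor>real M / q\<rfloor> in
        1 / (1 - (real r + 1) * lam) + 1 / (1 - real r * lam)
        + (real M - c * q) / (1 - (c + 1) * lam)
        + (q * (c + 1) - real M) / (1 - c * lam))"

definition Sigma_root :: "nat \<Rightarrow> nat \<Rightarrow> real \<Rightarrow> real" where
  "Sigma_root r M q =
     (THE lam. lam \<in> {1 / (real r + 1) <..< 1 / real r} \<and> Phi r M lam q = 0)"

definition C1_on_interval :: "real \<Rightarrow> real \<Rightarrow> (real \<Rightarrow> real) \<Rightarrow> bool" where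
  "C1_on_interval u v f \<longleftrightarrow>
     (\<exists>D. continuous_on {u..v} D \<and>
          (\<forall>x\<in>{u..v}. (f has_real_derivative D x) (at x within {u..v})))"

(* C1 up to and including the end points of each piece (one-sided derivatives there); this is
   stronger than the library's piecewise_C1_differentiable_on, which does not control the
   derivative near the break points.  For a = b the partition consists of one point. *)
definition piecewise_C1 :: "real \<Rightarrow> real \<Rightarrow> (real \<Rightarrow> real) \<Rightarrow> bool" where
  "piecewise_C1 a b f \<longleftrightarrow>
     (\<exists>(n::nat) x. x 0 = a \<and> x n = b \<and>
        (\<forall>i<n. x i < x (Suc i) \<and> C1_on_interval (x i) (x (Suc i)) f))"

end

(* On the range M / (c + 1) \<le> q \<le> M / c the function Phi is affine in q and strictly increasing in
   lam, with q-derivative of the sign of 1 - (2 c + 1) lam; since 1/(r+1) < lam < 1/r this sign is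
   positive for 2 c + 1 \<le> r and negative otherwise.  An exact secant identity for the root in terms
   of divided differences of Phi gives continuity, the C1 property and monotonicity together.

   For a spider with branch lengths l_i, an eigenvector of the Dirichlet-to-Neumann map that does
   not vanish at the centre is proportional to u_i = 1 / (1 - lam l_i), so the condition sum u_i = 0
   turns the eigenvalue into a root of Phi.  That this eigenvalue is the smallest nonzero one holds because
   only the longest branch has l_i > 1 / lam. *)

theory Submission
  imports Defs
begin

section \<open>The root of Phi\<close>

text \<open>The floor in \<open>Phi\<close> jumps where one of the two weights vanishes, so the
  formulas of neighbouring pieces agree at the common break point and all estimates can be made on
  closed pieces, with one-sided derivatives at their ends. The index c of a piece is kept strictly
  below r, even at q = M/r where the floor equals r: then \<open>1 - (c + 1) * lam\<close> stays
  positive and the only negative denominator is the one of the branch of length r + 1. The peak is a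
  break point because 1/lam lies strictly between consecutive integers, so the integer 2 c + 1
  cannot cross it within a piece; the direction changes only between c = s and c = s - 1. For the
  spider, the single negative denominator becomes a single negative square in a diagonal quadratic
  form, which the sum-zero condition compensates.\<close>

definition root_interval :: "nat \<Rightarrow> real set" where
  "root_interval r = {1 / (real r + 1) <..< 1 / real r}"

definition Phi_piece :: "nat \<Rightarrow> nat \<Rightarrow> nat \<Rightarrow> real \<Rightarrow> real \<Rightarrow> real" where
  "Phi_piece r M c lam q =
     1 / (1 - (real r + 1) * lam) + 1 / (1 - real r * lam)
     + (real M - real c * q) / (1 - (real c + 1) * lam)
     + (q * (real c + 1) - real M) / (1 - real c * lam)"

text \<open>Divided difference of \<^const>\<open>Phi_piece\<close> in the variable lam; the factors 1 keep its four
  terms in the common shape w k / ((1 - k l1) (1 - k l2)).\<close>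

definition lam_slope :: "nat \<Rightarrow> nat \<Rightarrow> nat \<Rightarrow> real \<Rightarrow> real \<Rightarrow> real \<Rightarrow> real" where
  "lam_slope r M c l1 l2 q =
     1 * (real r + 1) / ((1 - (real r + 1) * l1) * (1 - (real r + 1) * l2))
     + 1 * real r / ((1 - real r * l1) * (1 - real r * l2))
     + (real M - real c * q) * (real c + 1) / ((1 - (real c + 1) * l1) * (1 - (real c + 1) * l2))
     + (q * (real c + 1) - real M) * real c / ((1 - real c * l1) * (1 - real c * l2))"

definition q_slope :: "nat \<Rightarrow> real \<Rightarrow> real" where
  "q_slope c lam = (real c + 1) / (1 - real c * lam) - real c / (1 - (real c + 1) * lam)"

text \<open>For c > 0 this is [M / (c + 1), M / c]; the product form also covers c = 0, which is the only
  piece when r = 1.\<close>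

definition q_piece :: "nat \<Rightarrow> nat \<Rightarrow> real set" where
  "q_piece M c = {q. real c * q \<le> real M \<and> real M \<le> (real c + 1) * q}"

text \<open>The bound 2 places \<open>(real r + 1) * lam - 1\<close> in (0, 1), which later bounds
  the slope from below; it comes from lam \<le> r lam < 1.\<close>

lemma root_interval_bounds:
  assumes "lam \<in> root_interval r" "r \<ge> 1"
  shows "0 < lam" "(real r + 1) * lam > 1" "real r * lam < 1" "(real r + 1) * lam < 2"
proof -
  have l: "1 / (real r + 1) < lam" "lam < 1 / real r" and r: "real r \<ge> 1"
    using assms by (auto simp: root_interval_def)
  show 0: "0 < lam" using l(1) by (smt (verit) divide_pos_pos of_nat_0_le_iff)
  show "(real r + 1) * lam > 1" using l(1) by (simp add: divide_less_eq mult.commute)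
  show 1: "real r * lam < 1" using l(2) r by (simp add: less_divide_eq mult.commute)
  have "lam \<le> real r * lam" using 0 r by simp
  then show "(real r + 1) * lam < 2" using 1 by (simp add: algebra_simps)
qed

lemma root_interval_pos:
  assumes "lam \<in> root_interval r" "r \<ge> 1" "k \<le> real r"
  shows "1 - k * lam > 0"
proof -
  have "k * lam \<le> real r * lam"
    using assms root_interval_bounds(1)[OF assms(1,2)] by simp
  then show ?thesis using root_interval_bounds(3)[OF assms(1,2)] by linarith
qed

section \<open>Divided differences of Phi and its unique root\<close>

lemma divide_secant:
  fixes w k l1 l2 :: real
  assumes "1 - k * l1 \<noteq> 0" "1 - k * l2 \<noteq> 0"
  shows "w / (1 - k * l2) - w / (1 - k * l1) = (l2 - l1) * (w * k / ((1 - k * l1) * (1 - k * l2)))"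
  using assms by (simp add: field_simps)

lemma divide_secant_mono:
  fixes w k l1 l2 :: real
  assumes "0 \<le> w" "0 \<le> k" "l1 \<le> l2" "1 - k * l2 > 0"
  shows "w / (1 - k * l1) \<le> w / (1 - k * l2)"
proof -
  have "k * l1 \<le> k * l2" using assms by (intro mult_left_mono)
  then show ?thesis using assms by (intro divide_left_mono mult_pos_pos) auto
qed

lemma Phi_piece_diff_lam:
  assumes "l1 \<in> root_interval r" "l2 \<in> root_interval r" "r \<ge> 1" "c < r"
  shows "Phi_piece r M c l2 q - Phi_piece r M c l1 q = (l2 - l1) * lam_slope r M c l1 l2 q"
proof -
  have nz: "1 - real c * l \<noteq> 0" "1 - (real c + 1) * l \<noteq> 0" "1 - real r * l \<noteq> 0"
      "1 - (real r + 1) * l \<noteq> 0" if "l \<in> root_interval r" for l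
    using root_interval_pos[OF that, of "real c"] root_interval_pos[OF that, of "real c + 1"]
      root_interval_pos[OF that, of "real r"] root_interval_bounds[OF that] assms by auto
  note n = nz[OF assms(1)] nz[OF assms(2)]
  show ?thesis
    unfolding Phi_piece_def lam_slope_def distrib_left[of "l2 - l1"]
    using divide_secant[OF n(1,5), of "q * (real c + 1) - real M"]
      divide_secant[OF n(2,6), of "real M - real c * q"]
      divide_secant[OF n(3,7), of 1] divide_secant[OF n(4,8), of 1]
    by linarith
qed

lemma Phi_piece_diff_q:
  "Phi_piece r M c lam q2 - Phi_piece r M c lam q1 = (q2 - q1) * q_slope c lam"
proof -
  have "Phi_piece r M c lam q2 - Phi_piece r M c lam q1 =
      ((real M - real c * q2) - (real M - real c * q1)) / (1 - (real c + 1) * lam)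
      + ((q2 * (real c + 1) - real M) - (q1 * (real c + 1) - real M)) / (1 - real c * lam)"
    unfolding Phi_piece_def diff_divide_distrib by simp
  also have "\<dots> = (- (q2 - q1) * real c) / (1 - (real c + 1) * lam)
      + ((q2 - q1) * (real c + 1)) / (1 - real c * lam)"
    by (simp add: algebra_simps)
  also have "\<dots> = (q2 - q1) * q_slope c lam"
    unfolding q_slope_def by (simp add: algebra_simps diff_divide_distrib add_divide_distrib)
  finally show ?thesis .
qed

text \<open>The first term alone suffices: both factors of its denominator are negative of modulus
  below 1. The other terms are nonnegative because c + 1 \<le> r keeps their denominators positive.
  The bound yields uniqueness of the root and makes the slope a safe divisor.\<close>

lemma lam_slope_ge_1:
  assumes "l1 \<in> root_interval r" "l2 \<in> root_interval r" "r \<ge> 1" "c < r" "q \<in> q_piece M c"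
  shows "lam_slope r M c l1 l2 q \<ge> 1"
proof -
  note b1 = root_interval_bounds[OF assms(1,3)] and b2 = root_interval_bounds[OF assms(2,3)]
  define a where "a = (real r + 1) * l1 - 1"
  define b where "b = (real r + 1) * l2 - 1"
  have ab: "0 < a" "a < 1" "0 < b" "b < 1" using b1 b2 by (auto simp: a_def b_def)
  then have "a * b < 1" "0 < a * b" using mult_strict_mono[of a 1 b 1] by auto
  then have "1 \<le> (real r + 1) / (a * b)"
    using assms(3) by (simp add: le_divide_eq)
  moreover have "(1 - (real r + 1) * l1) * (1 - (real r + 1) * l2) = a * b"
    by (simp add: a_def b_def algebra_simps)
  moreover have "0 \<le> 1 * real r / ((1 - real r * l1) * (1 - real r * l2))"
    using b1 b2 by (intro divide_nonneg_nonneg mult_nonneg_nonneg) auto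
  moreover have "0 \<le> (real M - real c * q) * (real c + 1) /
      ((1 - (real c + 1) * l1) * (1 - (real c + 1) * l2))"
    using assms root_interval_pos[of l1 r "real c + 1"] root_interval_pos[of l2 r "real c + 1"]
    by (intro divide_nonneg_nonneg mult_nonneg_nonneg) (auto simp: q_piece_def)
  moreover have "0 \<le> (q * (real c + 1) - real M) * real c /
      ((1 - real c * l1) * (1 - real c * l2))"
    using assms root_interval_pos[of l1 r "real c"] root_interval_pos[of l2 r "real c"]
    by (intro divide_nonneg_nonneg mult_nonneg_nonneg) (auto simp: q_piece_def mult.commute)
  ultimately show ?thesis unfolding lam_slope_def by simp
qed

text \<open>The intermediate value theorem applies between hi, where the two leading terms cancel and the
  others are nonnegative, and lo, chosen so that the negative term equals - rest hi.\<close>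

lemma Phi_piece_root_ex:
  assumes "r \<ge> 1" "c < r" "q \<in> q_piece M c"
  shows "\<exists>lam \<in> root_interval r. Phi_piece r M c lam q = 0"
proof -
  define rest where "rest lam = 1 / (1 - real r * lam)
     + (real M - real c * q) / (1 - (real c + 1) * lam)
     + (q * (real c + 1) - real M) / (1 - real c * lam)" for lam
  have split: "Phi_piece r M c lam q = rest lam - 1 / ((real r + 1) * lam - 1)" for lam
    unfolding Phi_piece_def rest_def
    using minus_divide_right[of 1 "(real r + 1) * lam - 1"] by simp
  \<comment> \<open>Its reciprocal r + 1/2 is halfway between r and r + 1, so the two leading
    denominators are opposite there.\<close>
  define hi where "hi = 2 / (2 * real r + 1)"
  define K where "K = rest hi"
  define lo where "lo = (1 + 1 / K) / (real r + 1)"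
  have w: "real M - real c * q \<ge> 0" "q * (real c + 1) - real M \<ge> 0"
    using assms(3) by (auto simp: q_piece_def mult.commute)
  have r1: "real r \<ge> 1" using assms(1) by simp
  have hi: "hi \<in> root_interval r"
    using r1 by (auto simp: hi_def root_interval_def field_simps)
  have hi1: "1 - real r * hi = 1 / (2 * real r + 1)" "(real r + 1) * hi - 1 = 1 / (2 * real r + 1)"
    using r1 by (auto simp: hi_def field_simps)
  have "0 \<le> (real M - real c * q) / (1 - (real c + 1) * hi)"
    using w root_interval_pos[OF hi, of "real c + 1"] assms by simp
  moreover have "0 \<le> (q * (real c + 1) - real M) / (1 - real c * hi)"
    using w root_interval_pos[OF hi, of "real c"] assms by simp
  ultimately have K: "K \<ge> 2 * real r + 1"
    unfolding K_def rest_def hi1 by simp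
  have Kp: "K > 0" using K r1 by linarith
  \<comment> \<open>\<open>hi\<close> is the expression for \<open>lo\<close> with 2 r + 1 in place
    of K, so the bound on K gives lo \<le> hi.\<close>
  have "1 / K \<le> 1 / (2 * real r + 1)" using K r1 by (intro divide_left_mono) auto
  then have "lo \<le> (1 + 1 / (2 * real r + 1)) / (real r + 1)"
    unfolding lo_def by (intro divide_right_mono) auto
  also have "1 + 1 / (2 * real r + 1) = (real r + 1) * hi" using hi1(2) by linarith
  also have "\<dots> / (real r + 1) = hi" using r1 by simp
  finally have lohi: "lo \<le> hi" .
  have lo1: "1 / (real r + 1) < lo"
    unfolding lo_def using Kp by (intro divide_strict_right_mono) auto
  have lo: "lo \<in> root_interval r" using lo1 lohi hi by (auto simp: root_interval_def)
  have sub: "x \<in> root_interval r" if "lo \<le> x" "x \<le> hi" for x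
    using that lo hi by (auto simp: root_interval_def)
  \<comment> \<open>Every term of \<open>rest\<close> is nondecreasing in lam on the interval, and K
    is exactly the size of the negative term at \<open>lo\<close>.\<close>
  have "rest lo \<le> K"
    unfolding K_def rest_def using assms w lohi root_interval_pos[OF hi assms(1)]
    by (intro add_mono divide_secant_mono) auto
  moreover have "(real r + 1) * lo - 1 = 1 / K" using r1 by (simp add: lo_def)
  ultimately have "Phi_piece r M c lo q \<le> 0" by (simp add: split)
  moreover have "0 \<le> Phi_piece r M c hi q"
    using K by (simp add: split hi1 K_def)
  moreover have "continuous_on {lo..hi} (\<lambda>lam. Phi_piece r M c lam q)"
    unfolding Phi_piece_def
    apply (intro continuous_intros)
    subgoal using root_interval_bounds(2)[OF sub assms(1)] by fastforce
    subgoal using root_interval_bounds(3)[OF sub assms(1)] by fastforce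
    subgoal using root_interval_pos[OF sub assms(1), of _ "real c + 1"] assms(2) by fastforce
    subgoal using root_interval_pos[OF sub assms(1), of _ "real c"] assms(2) by fastforce
    done
  ultimately obtain lam where "lo \<le> lam" "lam \<le> hi" "Phi_piece r M c lam q = 0"
    using IVT'[of "\<lambda>lam. Phi_piece r M c lam q" lo 0 hi] lohi by auto
  then show ?thesis using sub by blast
qed

text \<open>The closed piece includes q = M/(c+1), where the floor is already c + 1. There both
  formulas lose one weight and reduce to the same term q / (1 - (c+1) lam).\<close>

lemma Phi_eq_piece:
  assumes "q > 0" "q \<in> q_piece M c"
  shows "Phi r M lam q = Phi_piece r M c lam q"
proof (cases "real M = (real c + 1) * q")
  case True
  have "real M / q = real c + 1" using True assms(1) by simp
  then have "\<lfloor>real M / q\<rfloor> = int c + 1" by (intro floor_unique) auto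
  moreover have "real M - (real c + 1) * q = 0" "q * (real c + 1 + 1) - real M = q"
    "real M - real c * q = q" "q * (real c + 1) - real M = 0"
    unfolding True by (auto simp: algebra_simps)
  ultimately show ?thesis
    unfolding Phi_def Phi_piece_def Let_def by simp
next
  case False
  have "real c \<le> real M / q" "real M / q < real c + 1"
    using assms False by (auto simp: q_piece_def le_divide_eq divide_less_eq)
  then have "\<lfloor>real M / q\<rfloor> = int c" by linarith
  then show ?thesis by (simp add: Phi_def Phi_piece_def Let_def)
qed

lemma q_piece_ex:
  assumes "r \<ge> 1" "M \<ge> 1" "q \<in> {real M / real r .. real M}"
  obtains c where "c < r" "q \<in> q_piece M c" "q > 0"
proof -
  have "real M / real r > 0" using assms by simp
  then have q: "q > 0" using assms(3) unfolding atLeastAtMost_iff by linarith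
  \<comment> \<open>Ceiling minus one instead of the floor: at q = M/r the floor would be r, whereas
    c < r is required.\<close>
  define c where "c = nat (\<lceil>real M / q\<rceil> - 1)"
  have p: "real M / q > 0" using q assms by simp
  then have c: "real c = of_int \<lceil>real M / q\<rceil> - 1" by (simp add: c_def)
  have "real c < real M / q" "real M / q \<le> real c + 1" unfolding c by linarith+
  then have "q \<in> q_piece M c"
    using q by (simp add: q_piece_def field_simps)
  moreover have "real M / q \<le> real r"
    using assms q by (simp add: field_simps)
  then have "c < r" using \<open>real c < real M / q\<close> by simp
  ultimately show ?thesis using that q by blast
qed

lemma Sigma_root_unique:
  assumes "r \<ge> 1" "M \<ge> 1" "q \<in> {real M / real r .. real M}"
  shows "\<exists>!lam. lam \<in> {1 / (real r + 1) <..< 1 / real r} \<and> Phi r M lam q = 0"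
proof -
  obtain c where c: "c < r" "q \<in> q_piece M c" "q > 0" using q_piece_ex assms by blast
  have eq: "Phi r M lam q = Phi_piece r M c lam q" for lam using Phi_eq_piece c by blast
  have "l1 = l2" if "l1 \<in> root_interval r" "l2 \<in> root_interval r"
    "Phi_piece r M c l1 q = 0" "Phi_piece r M c l2 q = 0" for l1 l2
    using Phi_piece_diff_lam[OF that(1,2) assms(1) c(1), of M q] that
      lam_slope_ge_1[OF that(1,2) assms(1) c(1,2)] by auto
  then show ?thesis
    using Phi_piece_root_ex[OF assms(1) c(1,2)]
    unfolding eq root_interval_def[symmetric] by blast
qed

lemma Sigma_root_works:
  assumes "r \<ge> 1" "M \<ge> 1" "q \<in> {real M / real r .. real M}"
  shows "Sigma_root r M q \<in> root_interval r" "Phi r M (Sigma_root r M q) q = 0"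
  using theI'[OF Sigma_root_unique[OF assms]]
  unfolding Sigma_root_def root_interval_def by auto

section \<open>The root as a function of q on one closed piece\<close>

lemma q_piece_subset:
  assumes "c \<ge> 1" "c < r" "M \<ge> 1" "q \<in> {real M / (real c + 1) .. real M / real c}"
  shows "q \<in> q_piece M c" "q > 0" "q \<in> {real M / real r .. real M}"
proof -
  have c: "real c \<ge> 1" "real c + 1 \<le> real r" "real M \<ge> 1" using assms by auto
  have q: "real M / (real c + 1) \<le> q" "q \<le> real M / real c" using assms by auto
  show "q > 0" using q(1) c by (smt (verit) divide_pos_pos)
  show "q \<in> q_piece M c" using q c by (simp add: q_piece_def field_simps)
  have "real M / real r \<le> real M / (real c + 1)" using c by (intro divide_left_mono) auto
  moreover have "real M / real c \<le> real M / 1" using c by (intro divide_left_mono) auto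
  ultimately show "q \<in> {real M / real r .. real M}" using q by auto
qed

text \<open>The lam-slope is taken at the new point q2 and the q-slope at the old root, so that the right-hand
  side stays bounded as q2 varies even when \<^const>\<open>q_slope\<close> blows up (for c + 1 = r and lam near 1/r).\<close>

lemma Sigma_root_secant:
  assumes "c \<ge> 1" "c < r" "M \<ge> 1"
    "q1 \<in> {real M / (real c + 1) .. real M / real c}"
    "q2 \<in> {real M / (real c + 1) .. real M / real c}"
  shows "(Sigma_root r M q2 - Sigma_root r M q1) *
      lam_slope r M c (Sigma_root r M q1) (Sigma_root r M q2) q2 =
      - (q2 - q1) * q_slope c (Sigma_root r M q1)"
    and "lam_slope r M c (Sigma_root r M q1) (Sigma_root r M q2) q2 \<ge> 1"
    and "Sigma_root r M q1 \<in> root_interval r"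
proof -
  have r: "r \<ge> 1" using assms by simp
  note s1 = q_piece_subset[OF assms(1-4)] and s2 = q_piece_subset[OF assms(1-3,5)]
  note w1 = Sigma_root_works[OF r assms(3) s1(3)] and w2 = Sigma_root_works[OF r assms(3) s2(3)]
  note e = w1(2)[unfolded Phi_eq_piece[OF s1(2,1)]] w2(2)[unfolded Phi_eq_piece[OF s2(2,1)]]
  show "(Sigma_root r M q2 - Sigma_root r M q1) *
      lam_slope r M c (Sigma_root r M q1) (Sigma_root r M q2) q2 =
      - (q2 - q1) * q_slope c (Sigma_root r M q1)"
    using Phi_piece_diff_lam[OF w1(1) w2(1) r assms(2), of M q2]
      Phi_piece_diff_q[of r M c "Sigma_root r M q1" q2 q1] e
    by (metis diff_0_right diff_0 mult_minus_left)
  show "lam_slope r M c (Sigma_root r M q1) (Sigma_root r M q2) q2 \<ge> 1"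
    using lam_slope_ge_1[OF w1(1) w2(1) r assms(2) s2(1)] .
  show "Sigma_root r M q1 \<in> root_interval r" by (fact w1(1))
qed

text \<open>With the slope at least 1, the secant identity becomes a Lipschitz estimate around q1
  whose constant depends only on the old root.\<close>

lemma Sigma_root_continuous_on_piece:
  assumes "c \<ge> 1" "c < r" "M \<ge> 1"
  shows "continuous_on {real M / (real c + 1) .. real M / real c} (Sigma_root r M)"
  unfolding continuous_on_def
proof
  fix q1 assume q1: "q1 \<in> {real M / (real c + 1) .. real M / real c}" (is "_ \<in> ?I")
  let ?S = "Sigma_root r M" and ?C = "q_slope c (Sigma_root r M q1)"
  have "norm (?S q2 - ?S q1) \<le> \<bar>q2 - q1\<bar> * \<bar>?C\<bar>" if "q2 \<in> ?I" for q2
  proof -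
    note s = Sigma_root_secant[OF assms q1 that]
    have "\<bar>?S q2 - ?S q1\<bar> * 1 \<le> \<bar>?S q2 - ?S q1\<bar> * \<bar>lam_slope r M c (?S q1) (?S q2) q2\<bar>"
      using s(2) by (intro mult_left_mono) auto
    then show ?thesis using arg_cong[OF s(1), of abs] by (simp add: abs_mult abs_minus_commute)
  qed
  then have "\<forall>\<^sub>F q2 in at q1 within ?I. norm (?S q2 - ?S q1) \<le> \<bar>q2 - q1\<bar> * \<bar>?C\<bar>"
    by (auto simp: eventually_at_filter)
  moreover have "((\<lambda>q2. \<bar>q2 - q1\<bar> * \<bar>?C\<bar>) \<longlongrightarrow> 0) (at q1 within ?I)"
    by (auto intro!: tendsto_eq_intros)
  ultimately have "((\<lambda>q2. ?S q2 - ?S q1) \<longlongrightarrow> 0) (at q1 within ?I)"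
    by (rule Lim_null_comparison)
  then show "(?S \<longlongrightarrow> ?S q1) (at q1 within ?I)"
    by (simp add: LIM_zero_iff)
qed

lemma Sigma_root_C1_piece:
  assumes "c \<ge> 1" "c < r" "M \<ge> 1"
  shows "C1_on_interval (real M / (real c + 1)) (real M / real c) (Sigma_root r M)"
proof -
  let ?S = "Sigma_root r M" and ?I = "{real M / (real c + 1) .. real M / real c}"
  \<comment> \<open>The implicit derivative, minus the q-derivative of Phi over its lam-derivative:
    on the diagonal the divided difference \<open>lam_slope\<close> is the partial derivative in
    lam.\<close>
  let ?D = "\<lambda>q. - q_slope c (?S q) / lam_slope r M c (?S q) (?S q) q"
  have r: "r \<ge> 1" using assms by simp
  have S: "?S q \<in> root_interval r" if "q \<in> ?I" for q using Sigma_root_secant(3)[OF assms that that] .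
  have nz: "1 - real c * ?S q \<noteq> 0" "1 - (real c + 1) * ?S q \<noteq> 0" "1 - real r * ?S q \<noteq> 0"
      "1 - (real r + 1) * ?S q \<noteq> 0" "lam_slope r M c (?S q) (?S q) q \<noteq> 0" if "q \<in> ?I" for q
    using root_interval_pos[OF S[OF that], of "real c"] root_interval_pos[OF S[OF that], of "real c + 1"]
      root_interval_pos[OF S[OF that], of "real r"] root_interval_bounds[OF S[OF that]] assms
      Sigma_root_secant(2)[OF assms that that] by auto
  note cont = Sigma_root_continuous_on_piece[OF assms]
  have "continuous_on ?I ?D"
    using nz unfolding q_slope_def lam_slope_def
    by (intro continuous_intros cont) (auto simp del: mult_eq_0_iff)
  moreover have "(?S has_real_derivative ?D q1) (at q1 within ?I)" if q1: "q1 \<in> ?I" for q1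
  proof -
    \<comment> \<open>The difference quotient is known exactly and depends on q2 only through its
      denominator, so continuity of the root suffices to pass to the limit, at the ends of the piece
      as well.\<close>
    have eq: "- q_slope c (?S q1) / lam_slope r M c (?S q1) (?S q2) q2 =
        (?S q2 - ?S q1) / (q2 - q1)" if "q2 \<in> ?I" "q2 \<noteq> q1" for q2
      using Sigma_root_secant(1,2)[OF assms q1 that(1)] that(2)
      by (subst frac_eq_eq) (auto simp: algebra_simps)
    have lim: "(?S \<longlongrightarrow> ?S q1) (at q1 within ?I)"
      using cont q1 by (auto simp: continuous_on_def)
    have "((\<lambda>q2. lam_slope r M c (?S q1) (?S q2) q2) \<longlongrightarrow> lam_slope r M c (?S q1) (?S q1) q1)
        (at q1 within ?I)"
      unfolding lam_slope_def using nz[OF q1]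
      by (intro tendsto_intros lim) auto
    then have "((\<lambda>q2. - q_slope c (?S q1) / lam_slope r M c (?S q1) (?S q2) q2) \<longlongrightarrow> ?D q1)
        (at q1 within ?I)"
      by (intro tendsto_intros nz[OF q1])
    moreover have "\<forall>\<^sub>F q2 in at q1 within ?I. - q_slope c (?S q1) / lam_slope r M c (?S q1) (?S q2) q2 =
        (?S q2 - ?S q1) / (q2 - q1)"
      unfolding eventually_at_filter using eq by (auto intro!: always_eventually)
    ultimately show ?thesis
      unfolding has_field_derivative_iff by (rule Lim_transform_eventually)
  qed
  ultimately show ?thesis unfolding C1_on_interval_def by blast
qed

lemma q_slope_eq:
  assumes "1 - real c * lam \<noteq> 0" "1 - (real c + 1) * lam \<noteq> 0"
  shows "q_slope c lam = (1 - (2 * real c + 1) * lam) / ((1 - real c * lam) * (1 - (real c + 1) * lam))"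
  unfolding q_slope_def using assms
  by (subst diff_frac_eq) (auto simp: algebra_simps)

lemma q_slope_sign:
  assumes "lam \<in> root_interval r" "c < r"
  shows "r < 2 * c + 1 \<Longrightarrow> q_slope c lam < 0" "2 * c + 1 \<le> r \<Longrightarrow> q_slope c lam > 0"
proof -
  have r: "r \<ge> 1" using assms by simp
  note p = root_interval_pos[OF assms(1) r, of "real c"] root_interval_pos[OF assms(1) r, of "real c + 1"]
  have p: "0 < 1 - real c * lam" "0 < 1 - (real c + 1) * lam" using p assms by auto
  note e = q_slope_eq[of c lam]
  { assume "r < 2 * c + 1"
    \<comment> \<open>Integrality: 2 c + 1 > r already means 2 c + 1 \<ge> r + 1, which exceeds
      1/lam.\<close>
    then have "real r + 1 \<le> 2 * real c + 1" by simp
    then have "(real r + 1) * lam \<le> (2 * real c + 1) * lam"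
      using root_interval_bounds(1)[OF assms(1) r] by (intro mult_right_mono) auto
    then show "q_slope c lam < 0"
      using root_interval_bounds(2)[OF assms(1) r] p e by (simp add: divide_neg_pos) }
  { assume "2 * c + 1 \<le> r"
    then have "2 * real c + 1 \<le> real r" by linarith
    then show "q_slope c lam > 0"
      using root_interval_pos[OF assms(1) r, of "2 * real c + 1"] p e by simp }
qed

lemma Sigma_root_mono_piece:
  assumes "c \<ge> 1" "c < r" "M \<ge> 1"
    "q1 \<in> {real M / (real c + 1) .. real M / real c}"
    "q2 \<in> {real M / (real c + 1) .. real M / real c}" "q1 < q2"
  shows "r < 2 * c + 1 \<Longrightarrow> Sigma_root r M q1 < Sigma_root r M q2"
    and "2 * c + 1 \<le> r \<Longrightarrow> Sigma_root r M q2 < Sigma_root r M q1"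
proof -
  note s = Sigma_root_secant[OF assms(1-5)]
  let ?d = "Sigma_root r M q2 - Sigma_root r M q1"
  let ?G = "lam_slope r M c (Sigma_root r M q1) (Sigma_root r M q2) q2"
  { assume "r < 2 * c + 1"
    then have "q_slope c (Sigma_root r M q1) < 0" using q_slope_sign(1)[OF s(3) assms(2)] by simp
    then have "0 < ?d * ?G" unfolding s(1) using assms(6) by (intro mult_neg_neg) auto
    then show "Sigma_root r M q1 < Sigma_root r M q2" using s(2) by (simp add: zero_less_mult_iff) }
  { assume "2 * c + 1 \<le> r"
    then have "q_slope c (Sigma_root r M q1) > 0" using q_slope_sign(2)[OF s(3) assms(2)] by simp
    then have "?d * ?G < 0" unfolding s(1) using assms(6) by (intro mult_neg_pos) auto
    then show "Sigma_root r M q2 < Sigma_root r M q1" using s(2) by (simp add: mult_less_0_iff) }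
qed

section \<open>Gluing the pieces along the break points\<close>

lemma strict_mono_on_glue:
  fixes x :: "nat \<Rightarrow> real" and f :: "real \<Rightarrow> real"
  assumes "\<And>i. i < n \<Longrightarrow> x i \<le> x (Suc i)" "\<And>i. i < n \<Longrightarrow> strict_mono_on {x i .. x (Suc i)} f"
  shows "strict_mono_on {x 0 .. x n} f"
  using assms
proof (induction n)
  case 0
  then show ?case by (auto intro!: strict_mono_onI)
next
  case (Suc n)
  then have IH: "strict_mono_on {x 0 .. x n} f" and L: "strict_mono_on {x n .. x (Suc n)} f"
    by simp_all
  show ?case
  proof (rule strict_mono_onI)
    fix a b assume ab: "a \<in> {x 0..x (Suc n)}" "b \<in> {x 0..x (Suc n)}" "a < b"
    consider "b \<le> x n" | "x n \<le> a" | "a < x n" "x n < b" by linarith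
    then show "f a < f b"
    proof cases
      case 1 then show ?thesis using ab strict_mono_onD[OF IH, of a b] by auto
    next
      case 2 then show ?thesis using ab strict_mono_onD[OF L, of a b] by auto
    next
      case 3
      then have "f a < f (x n)" using ab strict_mono_onD[OF IH, of a "x n"] by auto
      also have "\<dots> < f b" using 3 ab strict_mono_onD[OF L, of "x n" b] by auto
      finally show ?thesis .
    qed
  qed
qed

lemma continuous_on_glue:
  fixes x :: "nat \<Rightarrow> real" and f :: "real \<Rightarrow> real"
  assumes "\<And>i. i < n \<Longrightarrow> x i \<le> x (Suc i)" "\<And>i. i < n \<Longrightarrow> continuous_on {x i .. x (Suc i)} f"
  shows "x 0 \<le> x n" "continuous_on {x 0 .. x n} f"
proof -
  have "x 0 \<le> x n \<and> continuous_on {x 0 .. x n} f"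
    using assms
  proof (induction n)
    case (Suc n)
    then have "continuous_on ({x 0 .. x n} \<union> {x n .. x (Suc n)}) f"
      by (intro continuous_on_closed_Un) auto
    moreover have "x 0 \<le> x n" "x n \<le> x (Suc n)" using Suc by auto
    ultimately show ?case by (simp add: ivl_disj_un)
  qed auto
  then show "x 0 \<le> x n" "continuous_on {x 0 .. x n} f" by auto
qed

text \<open>Indexed so that q increases with i; the piece from i to i + 1 then has c = r - 1 - i.
  Only i < r is meaningful: beyond it the truncated difference is 0 and so is the quotient.\<close>

definition break_pt :: "nat \<Rightarrow> nat \<Rightarrow> nat \<Rightarrow> real" where
  "break_pt r M i = real M / real (r - i)"

lemma break_pt_piece:
  assumes "i < r - 1" "M \<ge> 1"
  obtains c where "c \<ge> 1" "c < r" "c = r - Suc i" "break_pt r M i = real M / (real c + 1)"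
    "break_pt r M (Suc i) = real M / real c" "break_pt r M i < break_pt r M (Suc i)"
proof -
  have "r - i = Suc (r - Suc i)" "r - Suc i \<ge> 1" "r - Suc i < r" using assms by auto
  then show ?thesis using that[of "r - Suc i"] assms
    by (simp add: break_pt_def divide_strict_left_mono add.commute)
qed

lemma break_pt_ends:
  assumes "r \<ge> 1"
  shows "break_pt r M 0 = real M / real r" "break_pt r M (r - 1) = real M"
  using assms by (auto simp: break_pt_def)

lemma Sigma_root_continuous_on:
  assumes "r \<ge> 1" "M \<ge> 1"
  shows "continuous_on {real M / real r .. real M} (Sigma_root r M)"
proof -
  have "continuous_on {break_pt r M 0 .. break_pt r M (r - 1)} (Sigma_root r M)"
  proof (rule continuous_on_glue(2))
    fix i assume i: "i < r - 1"
    obtain c where c: "c \<ge> 1" "c < r" "c = r - Suc i" "break_pt r M i = real M / (real c + 1)"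
      "break_pt r M (Suc i) = real M / real c" "break_pt r M i < break_pt r M (Suc i)"
      using break_pt_piece[OF i assms(2)] .
    show "break_pt r M i \<le> break_pt r M (Suc i)" using c(6) by simp
    show "continuous_on {break_pt r M i .. break_pt r M (Suc i)} (Sigma_root r M)"
      unfolding c(4,5) by (rule Sigma_root_continuous_on_piece[OF c(1,2) assms(2)])
  qed
  then show ?thesis unfolding break_pt_ends[OF assms(1)] .
qed

lemma Sigma_root_piecewise_C1:
  assumes "r \<ge> 1" "M \<ge> 1"
  shows "piecewise_C1 (real M / real r) (real M) (Sigma_root r M)"
  unfolding piecewise_C1_def
proof (intro exI conjI allI impI)
  show "break_pt r M 0 = real M / real r" "break_pt r M (r - 1) = real M"
    using break_pt_ends[OF assms(1)] by auto
  fix i assume i: "i < r - 1"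
  obtain c where c: "c \<ge> 1" "c < r" "c = r - Suc i" "break_pt r M i = real M / (real c + 1)"
    "break_pt r M (Suc i) = real M / real c" "break_pt r M i < break_pt r M (Suc i)"
    using break_pt_piece[OF i assms(2)] .
  show "break_pt r M i < break_pt r M (Suc i)" by (fact c(6))
  show "C1_on_interval (break_pt r M i) (break_pt r M (Suc i)) (Sigma_root r M)"
    unfolding c(4,5) by (rule Sigma_root_C1_piece[OF c(1,2) assms(2)])
qed

lemma Sigma_root_strict_mono_on:
  assumes "r \<ge> 1" "M \<ge> 1" "s \<ge> 1" "s \<le> r" "r \<le> 2 * s"
  shows "strict_mono_on {real M / real r .. real M / real s} (Sigma_root r M)"
proof -
  have "strict_mono_on {break_pt r M 0 .. break_pt r M (r - s)} (Sigma_root r M)"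
  proof (rule strict_mono_on_glue)
    fix i assume "i < r - s"
    then have i: "i < r - 1" "s \<le> r - Suc i" using assms by auto
    obtain c where c: "c \<ge> 1" "c < r" "c = r - Suc i" "break_pt r M i = real M / (real c + 1)"
      "break_pt r M (Suc i) = real M / real c" "break_pt r M i < break_pt r M (Suc i)"
      using break_pt_piece[OF i(1) assms(2)] .
    \<comment> \<open>Left of the peak c = r - 1 - i is at least s, and r \<le> 2 s.\<close>
    have "r < 2 * c + 1" using i c assms by linarith
    then show "strict_mono_on {break_pt r M i .. break_pt r M (Suc i)} (Sigma_root r M)"
      using Sigma_root_mono_piece(1)[OF c(1,2) assms(2)] unfolding c(4,5)
      by (intro strict_mono_onI) auto
    show "break_pt r M i \<le> break_pt r M (Suc i)" using c by auto
  qed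
  then show ?thesis using assms by (simp add: break_pt_def)
qed

lemma Sigma_root_strict_antimono_on:
  assumes "r \<ge> 1" "M \<ge> 1" "s \<ge> 1" "s \<le> r" "2 * s \<le> r + 1"
  shows "strict_antimono_on {real M / real s .. real M} (Sigma_root r M)"
proof -
  let ?x = "\<lambda>i. break_pt r M (r - s + i)"
  \<comment> \<open>Negating the root turns the decreasing case into an instance of the same gluing
    lemma.\<close>
  have "strict_mono_on {?x 0 .. ?x (s - 1)} (\<lambda>q. - Sigma_root r M q)"
  proof (rule strict_mono_on_glue)
    fix j assume j: "j < s - 1"
    let ?i = "r - s + j"
    have i: "?i < r - 1" using assms j by auto
    obtain c where c: "c \<ge> 1" "c < r" "c = r - Suc ?i" "break_pt r M ?i = real M / (real c + 1)"
      "break_pt r M (Suc ?i) = real M / real c" "break_pt r M ?i < break_pt r M (Suc ?i)"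
      using break_pt_piece[OF i(1) assms(2)] .
    \<comment> \<open>Right of the peak c = s - 1 - j, so 2 c + 1 \<le> 2 s - 1 \<le> r.\<close>
    have "2 * c + 1 \<le> r" using j c assms by linarith
    then show "strict_mono_on {?x j .. ?x (Suc j)} (\<lambda>q. - Sigma_root r M q)"
      using Sigma_root_mono_piece(2)[OF c(1,2) assms(2)] unfolding add_Suc_right c(4,5)
      by (intro strict_mono_onI) auto
    show "?x j \<le> ?x (Suc j)" using c by auto
  qed
  moreover have "?x 0 = real M / real s" "?x (s - 1) = real M"
    using assms by (auto simp: break_pt_def)
  ultimately show ?thesis
    by (auto simp: monotone_on_def)
qed

section \<open>Steklov eigenvalues of spiders\<close>

lemma nth_ge_1:
  fixes ls :: "nat list"
  assumes "0 \<notin> set ls" "i < length ls"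
  shows "1 \<le> ls ! i"
  using assms nth_mem[OF assms(2)] by (cases "ls ! i") auto

lemma verts_spider:
  assumes "length ls \<ge> 1"
  shows "verts (spider ls) = insert (0, 0) (SIGMA i:{..<length ls}. {1..ls ! i})"
proof (intro equalityI subsetI)
  fix v assume "v \<in> verts (spider ls)"
  then show "v \<in> insert (0, 0) (SIGMA i:{..<length ls}. {1..ls ! i})"
    by (auto simp: verts_def spider_def spider_vert_def split: if_splits)
next
  fix v assume "v \<in> insert (0, 0) (SIGMA i:{..<length ls}. {1..ls ! i})"
  then consider "v = (0, 0)" | i j where "v = (i, j)" "i < length ls" "1 \<le> j" "j \<le> ls ! i"
    by auto
  then show "v \<in> verts (spider ls)"
  proof cases
    case 1
    then have "v = spider_vert 0 0 \<and> 0 < length ls \<and> 0 \<le> ls ! 0"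
      using assms by (auto simp: spider_vert_def)
    then show ?thesis by (auto simp: verts_def spider_def)
  next
    case 2
    then have "v = spider_vert i j" by (simp add: spider_vert_def)
    then show ?thesis using 2 by (auto simp: verts_def spider_def)
  qed
qed

lemma edge_spider_iff:
  "{v, w} \<in> edges (spider ls) \<longleftrightarrow>
    (\<exists>i j. i < length ls \<and> j < ls ! i \<and>
      (v = spider_vert i j \<and> w = spider_vert i (Suc j) \<or>
       w = spider_vert i j \<and> v = spider_vert i (Suc j)))"
  by (auto simp: edges_def spider_def doubleton_eq_iff) 

lemma spider_vert_in_verts:
  assumes "i < length ls" "j \<le> ls ! i"
  shows "spider_vert i j \<in> verts (spider ls)"
  using assms by (auto simp: verts_def spider_def)

lemma nbrs_center:
  assumes "0 \<notin> set ls"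
  shows "nbrs (spider ls) (0, 0) = (\<lambda>i. (i, 1)) ` {..<length ls}"
proof (intro equalityI subsetI)
  fix w assume "w \<in> nbrs (spider ls) (0, 0)"
  then show "w \<in> (\<lambda>i. (i, 1)) ` {..<length ls}"
    by (auto simp: nbrs_def edge_spider_iff spider_vert_def split: if_splits)
next
  fix w :: "nat \<times> nat" assume "w \<in> (\<lambda>i. (i, 1)) ` {..<length ls}"
  then obtain i where i: "i < length ls" "w = spider_vert i 1" by (auto simp: spider_vert_def)
  have "{(0, 0), w} \<in> edges (spider ls)"
    unfolding edge_spider_iff using i nth_ge_1[OF assms i(1)]
    by (intro exI[of _ i] exI[of _ 0]) (auto simp: spider_vert_def)
  then show "w \<in> nbrs (spider ls) (0, 0)"
    using i nth_ge_1[OF assms i(1)] spider_vert_in_verts by (auto simp: nbrs_def)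
qed

lemma nbrs_branch:
  assumes "i < length ls" "1 \<le> j" "j \<le> ls ! i"
  shows "nbrs (spider ls) (i, j) =
    insert (spider_vert i (j - 1)) (if j < ls ! i then {(i, Suc j)} else {})"
proof (intro equalityI subsetI)
  fix w assume "w \<in> nbrs (spider ls) (i, j)"
  then obtain k m where "k < length ls" "m < ls ! k"
    "(i, j) = spider_vert k m \<and> w = spider_vert k (Suc m) \<or>
     w = spider_vert k m \<and> (i, j) = spider_vert k (Suc m)"
    by (auto simp: nbrs_def edge_spider_iff)
  then show "w \<in> insert (spider_vert i (j - 1)) (if j < ls ! i then {(i, Suc j)} else {})"
    using assms(2) by (auto simp: spider_vert_def split: if_splits)
next
  fix w assume "w \<in> insert (spider_vert i (j - 1)) (if j < ls ! i then {(i, Suc j)} else {})"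
  then consider "w = spider_vert i (j - 1)" | "j < ls ! i" "w = spider_vert i (Suc j)"
    by (auto simp: spider_vert_def split: if_splits)
  then show "w \<in> nbrs (spider ls) (i, j)"
  proof cases
    case 1
    have "{(i, j), w} \<in> edges (spider ls)"
      unfolding edge_spider_iff using 1 assms
      by (intro exI[of _ i] exI[of _ "j - 1"]) (auto simp: spider_vert_def)
    then show ?thesis
      using 1 assms spider_vert_in_verts[of i ls "j - 1"] by (auto simp: nbrs_def)
  next
    case 2
    have "{(i, j), w} \<in> edges (spider ls)"
      unfolding edge_spider_iff using 2 assms
      by (intro exI[of _ i] exI[of _ j]) (auto simp: spider_vert_def)
    then show ?thesis
      using 2 assms spider_vert_in_verts[of i ls "Suc j"] by (auto simp: nbrs_def)
  qed
qed

lemma sum_nbrs_center: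
  assumes "0 \<notin> set ls"
  shows "(\<Sum>w\<in>nbrs (spider ls) (0, 0). f w) = (\<Sum>i<length ls. f (spider_vert i 1))"
  unfolding nbrs_center[OF assms]
  by (subst sum.reindex) (auto simp: inj_on_def spider_vert_def)

lemma sum_nbrs_branch:
  assumes "i < length ls" "1 \<le> j" "j \<le> ls ! i"
  shows "(\<Sum>w\<in>nbrs (spider ls) (i, j). f w) =
    f (spider_vert i (j - 1)) + (if j < ls ! i then f (spider_vert i (Suc j)) else 0)"
  unfolding nbrs_branch[OF assms] by (auto simp: spider_vert_def)

text \<open>The centre has one neighbour per branch, so two branches are what keeps it from being a
  leaf.\<close>

lemma leaves_spider:
  assumes "length ls \<ge> 2" "0 \<notin> set ls"
  shows "leaves (spider ls) = (\<lambda>i. (i, ls ! i)) ` {..<length ls}"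
proof -
  have "card (nbrs (spider ls) (0, 0)) = length ls"
    unfolding nbrs_center[OF assms(2)] by (subst card_image) (auto simp: inj_on_def)
  moreover have "card (nbrs (spider ls) (i, j)) = 1 \<longleftrightarrow> j = ls ! i"
    if "i < length ls" "1 \<le> j" "j \<le> ls ! i" for i j
    unfolding nbrs_branch[OF that] using that by (auto simp: spider_vert_def card_insert_if)
  moreover have "verts (spider ls) = insert (0, 0) (SIGMA i:{..<length ls}. {1..ls ! i})"
    using verts_spider[of ls] assms(1) by linarith
  ultimately show ?thesis
    using assms(1) nth_ge_1[OF assms(2)] by (fastforce simp: leaves_def)
qed

lemma sum_leaves_spider:
  assumes "length ls \<ge> 2" "0 \<notin> set ls"
  shows "(\<Sum>\<omega>\<in>leaves (spider ls). f \<omega>) = (\<Sum>i<length ls. f (i, ls ! i))"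
  unfolding leaves_spider[OF assms] by (subst sum.reindex) (auto simp: inj_on_def)

section \<open>Harmonic extensions and their energy\<close>

definition branch_affine :: "nat list \<Rightarrow> real \<Rightarrow> (nat \<Rightarrow> real) \<Rightarrow> nat \<times> nat \<Rightarrow> real" where
  "branch_affine ls h0 d = restrict (\<lambda>(i, j). h0 + real j * d i) (verts (spider ls))"

lemma branch_affine_spider_vert:
  assumes "i < length ls" "j \<le> ls ! i"
  shows "branch_affine ls h0 d (spider_vert i j) = h0 + real j * d i"
  using spider_vert_in_verts[OF assms] by (simp add: branch_affine_def spider_vert_def)

lemma spider_nonleaf_cases:
  assumes "length ls \<ge> 2" "0 \<notin> set ls"
  shows "v \<in> verts (spider ls) - leaves (spider ls) \<longleftrightarrow>
    v = (0, 0) \<or> (\<exists>i j. v = (i, j) \<and> i < length ls \<and> 1 \<le> j \<and> j < ls ! i)"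
proof -
  have "verts (spider ls) = insert (0, 0) (SIGMA i:{..<length ls}. {1..ls ! i})"
    using verts_spider[of ls] assms(1) by linarith
  moreover have "(0, 0) \<notin> (\<lambda>i. (i, ls ! i)) ` {..<length ls}" using nth_ge_1[OF assms(2)] by force
  ultimately show ?thesis unfolding leaves_spider[OF assms] by (cases v) auto
qed

text \<open>At a vertex of degree two harmonicity says that the second difference vanishes, so h is
  affine along each branch; at the centre it is a Kirchhoff law for the slopes.\<close>

lemma harmonic_imp_branch_affine:
  assumes len: "length ls \<ge> 2" "0 \<notin> set ls"
    and ext: "h \<in> extensional (verts (spider ls))"
    and harm: "\<And>v. v \<in> verts (spider ls) - leaves (spider ls) \<Longrightarrow>
      (\<Sum>w\<in>nbrs (spider ls) v. h v - h w) = 0"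
  defines "e \<equiv> \<lambda>i. h (spider_vert i 1) - h (0, 0)"
  shows "h = branch_affine ls (h (0, 0)) e" "(\<Sum>i<length ls. e i) = 0"
proof -
  have "(\<Sum>w\<in>nbrs (spider ls) (0, 0). h (0, 0) - h w) = 0"
    using harm spider_nonleaf_cases[OF len] by blast
  then have "(\<Sum>i<length ls. - e i) = 0"
    unfolding sum_nbrs_center[OF len(2)] e_def minus_diff_eq .
  then show "(\<Sum>i<length ls. e i) = 0" by (simp add: sum_negf)
  \<comment> \<open>The recursion has order two, so the induction carries two consecutive
    values.\<close>
  have val: "h (spider_vert i j) = h (0, 0) + real j * e i \<and>
      h (spider_vert i (Suc j)) = h (0, 0) + real (Suc j) * e i"
    if "i < length ls" "j < ls ! i" for i j
    using that
  proof (induction j)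
    case 0
    then show ?case by (simp add: e_def spider_vert_def)
  next
    case (Suc j)
    have "(i, Suc j) \<in> verts (spider ls) - leaves (spider ls)"
      using Suc.prems spider_nonleaf_cases[OF len] by auto
    from harm[OF this] have "h (i, Suc j) - h (spider_vert i j) + (h (i, Suc j) - h (spider_vert i (Suc (Suc j)))) = 0"
      using Suc.prems sum_nbrs_branch[of i ls "Suc j" "\<lambda>w. h (i, Suc j) - h w"] by simp
    moreover have "h (i, Suc j) = h (spider_vert i (Suc j))" by (simp add: spider_vert_def)
    ultimately show ?case using Suc by (simp add: algebra_simps)
  qed
  have vs: "verts (spider ls) = insert (0, 0) (SIGMA i:{..<length ls}. {1..ls ! i})"
    using verts_spider[of ls] len(1) by linarith
  show "h = branch_affine ls (h (0, 0)) e"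
  proof
    fix v
    consider "v \<notin> verts (spider ls)" | "v = (0, 0)" |
      i j where "v = (i, j)" "i < length ls" "1 \<le> j" "j \<le> ls ! i"
      unfolding vs by (metis atLeastAtMost_iff insertE lessThan_iff SigmaE)
    then show "h v = branch_affine ls (h (0, 0)) e v"
    proof cases
      case 1
      then show ?thesis using extensional_arb[OF ext] by (simp add: branch_affine_def)
    next
      case 2
      then show ?thesis by (simp add: branch_affine_def vs)
    next
      case 3
      then have "v = spider_vert i (Suc (j - 1))" by (simp add: spider_vert_def)
      then show ?thesis
        using 3 val[of i "j - 1"] branch_affine_spider_vert[of i ls j "h (0, 0)" e] by simp
    qed
  qed
qed

text \<open>Resolves the definite description. Uniqueness: with equal leaf values, the slopes of two
  candidates differ on branch i by the difference of the centre values over \<open>ls ! i\<close>.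
  Both slope sums are 0 and the sum of the reciprocal lengths is positive, so the centre values
  agree.\<close>

lemma harmonic_ext_spider:
  assumes len: "length ls \<ge> 2" "0 \<notin> set ls"
    and d: "\<And>i. i < length ls \<Longrightarrow> h0 + real (ls ! i) * d i = g (i, ls ! i)"
    and d0: "(\<Sum>i<length ls. d i) = 0"
  shows "harmonic_ext (spider ls) g = branch_affine ls h0 d"
  unfolding harmonic_ext_def
proof (rule the_equality)
  let ?H = "branch_affine ls h0 d"
  have leaf: "?H (i, ls ! i) = h0 + real (ls ! i) * d i" if "i < length ls" for i
    using branch_affine_spider_vert[OF that order_refl, of h0 d] nth_ge_1[OF len(2) that]
    by (simp add: spider_vert_def)
  have c: "spider_vert i 0 = (0, 0)" for i by (simp add: spider_vert_def)
  have c0: "?H (0, 0) = h0"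
    using branch_affine_spider_vert[of 0 ls 0 h0 d] len(1) by (cases ls) (auto simp: c)
  have "(\<Sum>w\<in>nbrs (spider ls) v. ?H v - ?H w) = 0"
    if v: "v \<in> verts (spider ls) - leaves (spider ls)" for v
  proof -
    consider "v = (0, 0)" | i j where "v = (i, j)" "i < length ls" "1 \<le> j" "j < ls ! i"
      using v unfolding spider_nonleaf_cases[OF len] by blast
    then show ?thesis
    proof cases
      case 1
      have "(\<Sum>i<length ls. ?H (0, 0) - ?H (spider_vert i 1)) = (\<Sum>i<length ls. - d i)"
        by (intro sum.cong) (use nth_ge_1[OF len(2)] in \<open>auto simp: c0 branch_affine_spider_vert\<close>)
      then show ?thesis
        using d0 unfolding 1 sum_nbrs_center[OF len(2)] by (simp only: sum_negf minus_zero)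
    next
      case 2
      have H: "?H (i, j) = h0 + real j * d i"
        using branch_affine_spider_vert[of i ls j h0 d] 2 by (simp add: spider_vert_def)
      have "?H (spider_vert i (j - 1)) = h0 + (real j - 1) * d i"
        using 2 by (subst branch_affine_spider_vert) (auto simp: of_nat_diff)
      moreover have "?H (spider_vert i (Suc j)) = h0 + (real j + 1) * d i"
        using 2 by (subst branch_affine_spider_vert) (auto simp: add.commute)
      moreover have "(\<Sum>w\<in>nbrs (spider ls) (i, j). ?H (i, j) - ?H w) =
          ?H (i, j) - ?H (spider_vert i (j - 1)) + (?H (i, j) - ?H (spider_vert i (Suc j)))"
        using 2 by (subst sum_nbrs_branch) auto
      ultimately show ?thesis unfolding 2(1) H by (simp add: algebra_simps)
    qed
  qed
  moreover have "?H \<in> extensional (verts (spider ls))" by (simp add: branch_affine_def)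
  moreover have "\<forall>\<omega>\<in>leaves (spider ls). ?H \<omega> = g \<omega>"
    unfolding leaves_spider[OF len] using leaf d by simp
  ultimately show "?H \<in> extensional (verts (spider ls)) \<and>
      (\<forall>\<omega>\<in>leaves (spider ls). ?H \<omega> = g \<omega>) \<and>
      (\<forall>v\<in>verts (spider ls) - leaves (spider ls). (\<Sum>w\<in>nbrs (spider ls) v. ?H v - ?H w) = 0)"
    by blast
next
  fix h assume h: "h \<in> extensional (verts (spider ls)) \<and>
      (\<forall>\<omega>\<in>leaves (spider ls). h \<omega> = g \<omega>) \<and>
      (\<forall>v\<in>verts (spider ls) - leaves (spider ls). (\<Sum>w\<in>nbrs (spider ls) v. h v - h w) = 0)"
  define e where "e = (\<lambda>i. h (spider_vert i 1) - h (0, 0))"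
  have h_eq: "h = branch_affine ls (h (0, 0)) e" and e0: "(\<Sum>i<length ls. e i) = 0"
    using harmonic_imp_branch_affine[OF len, of h] h unfolding e_def by blast+
  have diff: "d i - e i = (h (0, 0) - h0) / real (ls ! i)" if "i < length ls" for i
  proof -
    have "h (i, ls ! i) = g (i, ls ! i)" using h that by (auto simp: leaves_spider[OF len])
    moreover have "h (i, ls ! i) = h (0, 0) + real (ls ! i) * e i"
      using branch_affine_spider_vert[OF that order_refl, of "h (0, 0)" e] nth_ge_1[OF len(2) that]
      by (simp add: spider_vert_def h_eq[symmetric])
    ultimately have "real (ls ! i) * (d i - e i) = h (0, 0) - h0"
      using d[OF that] unfolding right_diff_distrib by linarith
    then show ?thesis using nth_ge_1[OF len(2) that] by (simp add: eq_divide_eq mult.commute)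
  qed
  have "(h (0, 0) - h0) * (\<Sum>i<length ls. 1 / real (ls ! i)) = (\<Sum>i<length ls. d i - e i)"
    by (simp add: sum_distrib_left diff)
  also have "\<dots> = 0" using e0 d0 by (simp add: sum_subtractf)
  finally have "h (0, 0) = h0 \<or> (\<Sum>i<length ls. 1 / real (ls ! i)) = 0" by simp
  moreover have "(\<Sum>i<length ls. 1 / real (ls ! i)) > 0"
    using len(1) nth_ge_1[OF len(2)] by (intro sum_pos) (auto simp: Suc_le_eq lessThan_empty_iff)
  ultimately have "h (0, 0) = h0" by simp
  moreover from this have "e i = d i" if "i < length ls" for i using diff[OF that] by simp
  moreover have "snd v = 0 \<or> fst v < length ls" if "v \<in> verts (spider ls)" for v
  proof -
    have "length ls \<ge> 1" using len(1) by simp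
    then show ?thesis using that verts_spider by auto
  qed
  ultimately have "branch_affine ls (h (0, 0)) e = branch_affine ls h0 d"
    unfolding branch_affine_def by (intro restrict_ext) force
  with h_eq show "h = branch_affine ls h0 d" by (rule trans)
qed

text \<open>Each of the \<open>ls ! i\<close> edges of branch i carries the same difference
  \<open>d i\<close>.\<close>

lemma energy_branch_affine:
  assumes len: "length ls \<ge> 2" "0 \<notin> set ls"
  shows "energy (spider ls) (branch_affine ls h0 d) = (\<Sum>i<length ls. real (ls ! i) * (d i)\<^sup>2)"
proof -
  let ?H = "branch_affine ls h0 d"
  let ?f = "\<lambda>v. \<Sum>w\<in>nbrs (spider ls) v. (?H v - ?H w)\<^sup>2"
  have c: "spider_vert i 0 = (0, 0)" for i by (simp add: spider_vert_def)
  have c0: "?H (0, 0) = h0"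
    using branch_affine_spider_vert[of 0 ls 0 h0 d] len(1) by (cases ls) (auto simp: c)
  have center: "?f (0, 0) = (\<Sum>i<length ls. (d i)\<^sup>2)"
    unfolding sum_nbrs_center[OF len(2)]
    by (intro sum.cong) (use nth_ge_1[OF len(2)] in \<open>auto simp: c0 branch_affine_spider_vert\<close>)
  have branch: "?f (i, j) = (d i)\<^sup>2 + (if j < ls ! i then (d i)\<^sup>2 else 0)"
    if "i < length ls" "j \<in> {1..ls ! i}" for i j
  proof -
    have j: "1 \<le> j" "j \<le> ls ! i" using that by auto
    have "(i, j) = spider_vert i j" using j by (simp add: spider_vert_def)
    then have H: "?H (i, j) = h0 + real j * d i"
      using branch_affine_spider_vert[OF that(1) j(2)] by simp
    show ?thesis
      unfolding sum_nbrs_branch[OF that(1) j] H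
      using that j by (auto simp: branch_affine_spider_vert of_nat_diff algebra_simps)
  qed
  \<comment> \<open>All vertices of the branch but the leaf meet two edges. The missing visit is
    made from the centre, which brings the count to \<open>2 * ls ! i\<close> before
    halving.\<close>
  have inner: "(\<Sum>j\<in>{1..ls ! i}. ?f (i, j)) = (2 * real (ls ! i) - 1) * (d i)\<^sup>2" if "i < length ls" for i
  proof -
    have "(\<Sum>j\<in>{1..ls ! i}. ?f (i, j)) = (\<Sum>j\<in>{1..ls ! i}. (d i)\<^sup>2) +
        (\<Sum>j\<in>{1..ls ! i}. if j < ls ! i then (d i)\<^sup>2 else 0)"
      unfolding sum.distrib[symmetric] using branch[OF that] by (intro sum.cong) auto
    also have "(\<Sum>j\<in>{1..ls ! i}. if j < ls ! i then (d i)\<^sup>2 else 0) = (\<Sum>j\<in>{1..<ls ! i}. (d i)\<^sup>2)"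
      by (intro sum.mono_neutral_cong_right) auto
    finally show ?thesis using nth_ge_1[OF len(2) that] by (simp add: of_nat_diff algebra_simps)
  qed
  have "(\<Sum>v\<in>verts (spider ls). ?f v) = ?f (0, 0) + (\<Sum>v\<in>(SIGMA i:{..<length ls}. {1..ls ! i}). ?f v)"
    using verts_spider[of ls] len(1) by (subst verts_spider) auto
  also have "(\<Sum>v\<in>(SIGMA i:{..<length ls}. {1..ls ! i}). ?f v) =
      (\<Sum>i<length ls. \<Sum>j\<in>{1..ls ! i}. ?f (i, j))"
    by (subst sum.Sigma) auto
  also have "\<dots> = (\<Sum>i<length ls. (2 * real (ls ! i) - 1) * (d i)\<^sup>2)"
    using inner by (intro sum.cong) auto
  finally have "(\<Sum>v\<in>verts (spider ls). ?f v) =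
      (\<Sum>i<length ls. (d i)\<^sup>2 + (2 * real (ls ! i) - 1) * (d i)\<^sup>2)"
    by (simp only: center sum.distrib)
  also have "\<dots> = 2 * (\<Sum>i<length ls. real (ls ! i) * (d i)\<^sup>2)"
    unfolding sum_distrib_left by (intro sum.cong) (auto simp: algebra_simps)
  finally show ?thesis unfolding energy_def by simp
qed

section \<open>The minimal Rayleigh quotient\<close>

lemma harmonic_slopes_exist:
  assumes "length ls \<ge> 1" "0 \<notin> set ls"
  obtains h0 :: real and d where "\<And>i. i < length ls \<Longrightarrow> h0 + real (ls ! i) * d i = g i"
    "(\<Sum>i<length ls. d i) = 0"
proof -
  let ?s = "\<Sum>i<length ls. 1 / real (ls ! i)"
  \<comment> \<open>The mean of the leaf values weighted by the conductances 1 /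
    \<open>ls ! i\<close>, the only centre value for which the slopes sum to 0.\<close>
  define h0 where "h0 = (\<Sum>i<length ls. g i / real (ls ! i)) / ?s"
  have "?s > 0"
    using assms(1) nth_ge_1[OF assms(2)] by (intro sum_pos) (auto simp: Suc_le_eq lessThan_empty_iff)
  then have h: "h0 * ?s = (\<Sum>i<length ls. g i / real (ls ! i))" by (simp add: h0_def)
  show ?thesis
  proof (rule that)
    show "h0 + real (ls ! i) * ((g i - h0) / real (ls ! i)) = g i" if "i < length ls" for i
      using nth_ge_1[OF assms(2) that] by simp
    show "(\<Sum>i<length ls. (g i - h0) / real (ls ! i)) = 0"
      using h by (simp add: diff_divide_distrib sum_subtractf sum_distrib_left)
  qed
qed

text \<open>Completing the square with e i - t / p i, where t = p k e k makes the one negative term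
  vanish.\<close>

lemma quadratic_form_nonneg:
  fixes p e :: "'a \<Rightarrow> real"
  assumes "finite I" "k \<in> I" "p k < 0" "\<And>i. i \<in> I \<Longrightarrow> i \<noteq> k \<Longrightarrow> p i > 0"
    "(\<Sum>i\<in>I. e i) = 0" "(\<Sum>i\<in>I. 1 / p i) \<le> 0"
  shows "(\<Sum>i\<in>I. p i * (e i)\<^sup>2) \<ge> 0"
proof -
  define t where "t = p k * e k"
  have nz: "p i \<noteq> 0" if "i \<in> I" for i using assms(3) assms(4)[OF that] by (cases "i = k") auto
  have "0 \<le> (\<Sum>i\<in>I. p i * (e i - t / p i)\<^sup>2)"
  proof (rule sum_nonneg)
    fix i assume "i \<in> I"
    then show "0 \<le> p i * (e i - t / p i)\<^sup>2"
      using assms(3) less_imp_le[OF assms(4)] by (cases "i = k") (auto simp: t_def)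
  qed
  also have "\<dots> = (\<Sum>i\<in>I. p i * (e i)\<^sup>2 - 2 * t * e i + t\<^sup>2 * (1 / p i))"
    by (intro sum.cong refl) (use nz in \<open>simp add: power2_eq_square field_simps\<close>)
  also have "\<dots> = (\<Sum>i\<in>I. p i * (e i)\<^sup>2) + t\<^sup>2 * (\<Sum>i\<in>I. 1 / p i)"
    by (simp only: sum.distrib sum_subtractf sum_distrib_left[symmetric] assms(5))
  also have "\<dots> \<le> (\<Sum>i\<in>I. p i * (e i)\<^sup>2)"
    using assms(6) by (simp add: mult_nonneg_nonpos)
  finally show ?thesis .
qed

text \<open>Writing g = h u + e with u the eigenvector, all mixed terms cancel, and the
  difference of the two sides is the quadratic form of e with weights 1 / l i - \<sigma>.\<close>

lemma rayleigh_lower_bound: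
  fixes l d :: "nat \<Rightarrow> real"
  assumes "n \<ge> 1" "\<sigma> > 0" "\<And>i. i < n \<Longrightarrow> l i > 0"
    "1 - \<sigma> * l 0 < 0" "\<And>i. 0 < i \<Longrightarrow> i < n \<Longrightarrow> 1 - \<sigma> * l i > 0"
    "(\<Sum>i<n. 1 / (1 - \<sigma> * l i)) = 0"
    "\<And>i. i < n \<Longrightarrow> h + l i * d i = g i" "(\<Sum>i<n. g i) = 0"
  shows "\<sigma> * (\<Sum>i<n. (g i)\<^sup>2) \<le> (\<Sum>i<n. l i * (d i)\<^sup>2)"
proof -
  define u where "u i = 1 / (1 - \<sigma> * l i)" for i
  define e where "e i = g i - h * u i" for i
  define p where "p i = 1 / l i - \<sigma>" for i
  have nz: "1 - \<sigma> * l i \<noteq> 0" if "i < n" for i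
    using assms(4) assms(5)[OF _ that] by (cases "i = 0") auto
  have u: "\<sigma> * l i * u i = u i - 1" if "i < n" for i
    using nz[OF that] by (simp add: u_def field_simps)
  have su: "(\<Sum>i<n. u i) = 0" using assms(6) by (simp add: u_def)
  have pe: "p i = (1 - \<sigma> * l i) / l i" if "i < n" for i
    using assms(3)[OF that] by (simp add: p_def field_simps)
  have "(\<Sum>i<n. p i * (e i)\<^sup>2) \<ge> 0"
  proof (rule quadratic_form_nonneg)
    show "finite {..<n}" "0 \<in> {..<n}" using assms(1) by auto
    show "p 0 < 0" using pe[of 0] assms(1,3,4) by (simp add: divide_neg_pos)
    show "p i > 0" if "i \<in> {..<n}" "i \<noteq> 0" for i using that pe[of i] assms(3,5) by simp
    show "(\<Sum>i<n. e i) = 0"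
      using su assms(8) by (simp add: e_def sum_subtractf sum_distrib_left[symmetric])
    \<comment> \<open>Since 1 / p i = l i * u i, the root equation makes these reciprocals sum to -
      n / \<sigma>, which is the sign condition of the quadratic form.\<close>
    have "1 / p i = (u i - 1) / \<sigma>" if "i < n" for i
    proof -
      have "1 / p i = l i * u i" using pe[OF that] by (simp add: u_def)
      then show ?thesis using u[OF that] assms(2) by (simp add: eq_divide_eq mult.commute mult.left_commute)
    qed
    then have "(\<Sum>i<n. 1 / p i) = (\<Sum>i<n. (u i - 1) / \<sigma>)" by (intro sum.cong) auto
    also have "\<dots> = - real n / \<sigma>" using su by (simp add: sum_divide_distrib[symmetric] sum_subtractf)
    finally show "(\<Sum>i<n. 1 / p i) \<le> 0" using assms(2) by (simp add: divide_nonpos_pos)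
  qed
  also have "(\<Sum>i<n. p i * (e i)\<^sup>2) =
      (\<Sum>i<n. l i * (d i)\<^sup>2 - \<sigma> * (g i)\<^sup>2 + \<sigma> * h\<^sup>2 * u i)"
  proof (intro sum.cong refl)
    fix i assume "i \<in> {..<n}"
    then have i: "i < n" by simp
    have l: "l i > 0" using assms(3)[OF i] .
    have g: "g i = e i + h * u i" by (simp add: e_def)
    \<comment> \<open>The slope d i splits into e i / l i and the slope
      \<open>\<sigma> * h * u i\<close> of h times the eigenvector.\<close>
    have "l i * d i = e i + h * (u i - 1)" using assms(7)[OF i] g by (simp add: algebra_simps)
    also have "\<dots> = l i * (e i / l i + \<sigma> * h * u i)"
      unfolding u[OF i, symmetric] using l by (simp add: field_simps)
    finally have d: "d i = e i / l i + \<sigma> * h * u i" using l by simp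
    have "l i * (d i)\<^sup>2 = (e i)\<^sup>2 / l i + 2 * \<sigma> * h * e i * u i + \<sigma> * h\<^sup>2 * u i * (\<sigma> * l i * u i)"
      unfolding d using l by (simp add: power2_eq_square field_simps)
    then show "p i * (e i)\<^sup>2 = l i * (d i)\<^sup>2 - \<sigma> * (g i)\<^sup>2 + \<sigma> * h\<^sup>2 * u i"
      unfolding u[OF i] g p_def using l by (simp add: power2_eq_square algebra_simps)
  qed
  \<comment> \<open>The remainder \<open>\<sigma> * h\<^sup>2 * u i\<close> sums to 0 by the root
    equation.\<close>
  also have "\<dots> = (\<Sum>i<n. l i * (d i)\<^sup>2) - \<sigma> * (\<Sum>i<n. (g i)\<^sup>2)"
    using su by (simp add: sum.distrib sum_subtractf sum_distrib_left[symmetric])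
  finally show ?thesis by simp
qed

text \<open>One eigenvector u, with value 1 at the centre, serves both directions: its leaf values
  attain \<sigma>, and every competitor is compared with a multiple of u by
  \<open>rayleigh_lower_bound\<close>.\<close>

lemma steklov_lambda2_spider:
  assumes len: "length ls \<ge> 2" "0 \<notin> set ls"
    and \<sigma>: "\<sigma> > 0" "1 - \<sigma> * real (ls ! 0) < 0"
      "\<And>i. 0 < i \<Longrightarrow> i < length ls \<Longrightarrow> 1 - \<sigma> * real (ls ! i) > 0"
      "(\<Sum>i<length ls. 1 / (1 - \<sigma> * real (ls ! i))) = 0"
  shows "steklov_lambda2 (spider ls) = \<sigma>"
  unfolding steklov_lambda2_def
proof (rule Least_equality)
  let ?u = "\<lambda>i. 1 / (1 - \<sigma> * real (ls ! i))"
  \<comment> \<open>Only leaf values count, so u can be written as a function of the distance j,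
    which equals \<open>ls ! i\<close> at the leaf.\<close>
  let ?g = "\<lambda>(i, j). 1 / (1 - \<sigma> * real j)"
  have nz: "1 - \<sigma> * real (ls ! i) \<noteq> 0" if "i < length ls" for i
    using \<sigma>(2) \<sigma>(3)[OF _ that] by (cases "i = 0") auto
  have u: "1 + real (ls ! i) * (\<sigma> * ?u i) = ?u i" if "i < length ls" for i
    using nz[OF that] by (simp add: field_simps)
  have "harmonic_ext (spider ls) ?g = branch_affine ls 1 (\<lambda>i. \<sigma> * ?u i)"
  proof (rule harmonic_ext_spider[OF len])
    show "1 + real (ls ! i) * (\<sigma> * ?u i) = ?g (i, ls ! i)" if "i < length ls" for i
      using u[OF that] by simp
    show "(\<Sum>i<length ls. \<sigma> * ?u i) = 0"
      using \<sigma>(4) by (simp only: sum_distrib_left[symmetric] mult_zero_right)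
  qed
  then have "energy (spider ls) (harmonic_ext (spider ls) ?g) =
      (\<Sum>i<length ls. real (ls ! i) * (\<sigma> * ?u i)\<^sup>2)"
    by (simp only: energy_branch_affine[OF len])
  \<comment> \<open>Uses that length times slope is \<open>?u i - 1\<close>; the resulting linear
    term disappears in the sum.\<close>
  also have "\<dots> = (\<Sum>i<length ls. \<sigma> * (?u i)\<^sup>2 - \<sigma> * ?u i)"
  proof (intro sum.cong refl)
    fix i assume "i \<in> {..<length ls}"
    then have "real (ls ! i) * (\<sigma> * ?u i) = ?u i - 1" using u[of i] by simp
    then have "real (ls ! i) * (\<sigma> * ?u i) * (\<sigma> * ?u i) = (?u i - 1) * (\<sigma> * ?u i)" by simp
    then show "real (ls ! i) * (\<sigma> * ?u i)\<^sup>2 = \<sigma> * (?u i)\<^sup>2 - \<sigma> * ?u i"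
      by (simp only: power2_eq_square algebra_simps)
  qed
  also have "\<dots> = \<sigma> * (\<Sum>i<length ls. (?u i)\<^sup>2)"
    using \<sigma>(4) by (simp only: sum_subtractf sum_distrib_left[symmetric])
  finally have en: "energy (spider ls) (harmonic_ext (spider ls) ?g) =
      \<sigma> * (\<Sum>\<omega>\<in>leaves (spider ls). (?g \<omega>)\<^sup>2)"
    by (simp add: sum_leaves_spider[OF len])
  have "0 < (\<Sum>i<length ls. (?u i)\<^sup>2)"
    using nz len(1) by (intro sum_pos) (auto simp: lessThan_empty_iff)
  then have pos: "0 < (\<Sum>\<omega>\<in>leaves (spider ls). (?g \<omega>)\<^sup>2)"
    by (simp add: sum_leaves_spider[OF len])
  have "(0, ls ! 0) \<in> leaves (spider ls)" using len(1) by (auto simp: leaves_spider[OF len])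
  then have "\<exists>\<omega>\<in>leaves (spider ls). ?g \<omega> \<noteq> 0" using nz[of 0] len(1) by force
  moreover have "(\<Sum>\<omega>\<in>leaves (spider ls). ?g \<omega>) = 0"
    using \<sigma>(4) by (simp add: sum_leaves_spider[OF len])
  moreover have "\<sigma> = energy (spider ls) (harmonic_ext (spider ls) ?g) /
      (\<Sum>\<omega>\<in>leaves (spider ls). (?g \<omega>)\<^sup>2)"
    unfolding en using pos by simp
  ultimately show "\<sigma> \<in> {energy (spider ls) (harmonic_ext (spider ls) g) /
      (\<Sum>\<omega>\<in>leaves (spider ls). (g \<omega>)\<^sup>2) | g.
      (\<exists>\<omega>\<in>leaves (spider ls). g \<omega> \<noteq> 0) \<and> (\<Sum>\<omega>\<in>leaves (spider ls). g \<omega>) = 0}"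
    by blast
next
  fix \<rho> assume "\<rho> \<in> {energy (spider ls) (harmonic_ext (spider ls) g) /
      (\<Sum>\<omega>\<in>leaves (spider ls). (g \<omega>)\<^sup>2) | g.
      (\<exists>\<omega>\<in>leaves (spider ls). g \<omega> \<noteq> 0) \<and> (\<Sum>\<omega>\<in>leaves (spider ls). g \<omega>) = 0}"
  then obtain g where \<rho>: "\<rho> = energy (spider ls) (harmonic_ext (spider ls) g) /
        (\<Sum>\<omega>\<in>leaves (spider ls). (g \<omega>)\<^sup>2)"
    and g: "\<exists>\<omega>\<in>leaves (spider ls). g \<omega> \<noteq> 0" "(\<Sum>\<omega>\<in>leaves (spider ls). g \<omega>) = 0"
    by blast
  have "length ls \<ge> 1" using len(1) by simp
  then obtain h0 d where d: "\<And>i. i < length ls \<Longrightarrow> h0 + real (ls ! i) * d i = g (i, ls ! i)"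
      "(\<Sum>i<length ls. d i) = 0"
    using harmonic_slopes_exist[of ls "\<lambda>i. g (i, ls ! i)"] len(2) by blast
  have "energy (spider ls) (harmonic_ext (spider ls) g) = (\<Sum>i<length ls. real (ls ! i) * (d i)\<^sup>2)"
  proof -
    have "harmonic_ext (spider ls) g = branch_affine ls h0 d"
      by (rule harmonic_ext_spider[OF len d])
    then show ?thesis using energy_branch_affine[OF len] by simp
  qed
  moreover have "\<sigma> * (\<Sum>i<length ls. (g (i, ls ! i))\<^sup>2) \<le> (\<Sum>i<length ls. real (ls ! i) * (d i)\<^sup>2)"
  proof (rule rayleigh_lower_bound[where h = h0])
    show "(\<Sum>i<length ls. g (i, ls ! i)) = 0"
      using g(2) by (simp add: sum_leaves_spider[OF len])
    show "0 < real (ls ! i)" if "i < length ls" for i using nth_ge_1[OF len(2) that] by simp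
  qed (use len(1) \<sigma> d in auto)
  moreover obtain \<omega> where "\<omega> \<in> leaves (spider ls)" "g \<omega> \<noteq> 0" using g(1) by blast
  then have "0 < (\<Sum>\<omega>\<in>leaves (spider ls). (g \<omega>)\<^sup>2)"
    by (intro sum_pos2[of _ \<omega>]) (auto simp: leaves_spider[OF len])
  ultimately show "\<sigma> \<le> \<rho>"
    unfolding \<rho> by (simp add: sum_leaves_spider[OF len] le_divide_eq)
qed

text \<open>For integer q the floor in \<open>Phi\<close> is the quotient c, and Phi is the sum of 1
  / (1 - lam l) over the branch lengths l. What has to be checked is that no branch except the first
  is longer than r.\<close>

lemma steklov_lambda2_AS:
  assumes "r \<ge> 1" "M \<ge> 1" "real M / real r \<le> real q" "q \<le> M" "M = q * c + t" "t < q"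
  shows "steklov_lambda2 (AS r (q + 2) c t) = Sigma_root r M (real q)"
proof -
  let ?ls = "[r + 1, r] @ replicate t (c + 1) @ replicate (q - t) c"
  let ?S = "Sigma_root r M (real q)"
  have q: "real q \<in> {real M / real r .. real M}" using assms(3,4) by simp
  note S = Sigma_root_works[OF assms(1,2) q]
  note b = root_interval_bounds[OF S(1) assms(1)]
  have qM: "q * c + t \<le> q * r"
    using assms(1,3,5) by (simp add: divide_le_eq mult.commute flip: of_nat_mult of_nat_add)
  have "c \<noteq> 0" using assms(4-6) by (cases c) auto
  have "q * c \<le> q * r" using qM by linarith
  then have "c \<le> r" using assms(6) by simp
  \<comment> \<open>c = r does occur, at q = M/r; then t = 0 and there is no branch of length c +
    1.\<close>
  have cr: "c + 1 \<le> r" if "t > 0"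
  proof -
    have "q * c < q * r" using qM that by linarith
    then show ?thesis by simp
  qed
  have "M div q = c" using assms(5,6) by simp
  then have fl: "\<lfloor>real M / real q\<rfloor> = int c" by (simp add: floor_divide_of_nat_eq)
  have Mt: "real M - real c * real q = real t" "real q * (real c + 1) - real M = real (q - t)"
    using assms(5,6) by (simp_all add: of_nat_diff algebra_simps)
  have "steklov_lambda2 (spider ?ls) = ?S"
  proof (rule steklov_lambda2_spider)
    show "2 \<le> length ?ls" by simp
    show "0 \<notin> set ?ls" using assms(1) \<open>c \<noteq> 0\<close> by auto
    show "?S > 0" by (fact b(1))
    show "1 - ?S * real (?ls ! 0) < 0" using b(2) by (simp add: algebra_simps)
    show "1 - ?S * real (?ls ! i) > 0" if "0 < i" "i < length ?ls" for i
    proof -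
      have "?ls ! i = (r # replicate t (c + 1) @ replicate (q - t) c) ! (i - 1)"
        using that by (cases i) auto
      moreover have "i - 1 < length (r # replicate t (c + 1) @ replicate (q - t) c)"
        using that by simp
      ultimately have "?ls ! i \<in> set (r # replicate t (c + 1) @ replicate (q - t) c)"
        using nth_mem by metis
      then have "?ls ! i \<le> r" using \<open>c \<le> r\<close> cr by (auto split: if_splits)
      then have "real (?ls ! i) \<le> real r" by (simp only: of_nat_le_iff)
      from root_interval_pos[OF S(1) assms(1) this] show ?thesis by (simp only: mult.commute)
    qed
    have "(\<Sum>i<length ?ls. 1 / (1 - ?S * real (?ls ! i))) =
        sum_list (map (\<lambda>l. 1 / (1 - ?S * real l)) ?ls)"
      unfolding sum_list_sum_nth length_map atLeast0LessThan
      by (intro sum.cong refl) (simp only: lessThan_iff nth_map)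
    \<comment> \<open>By \<open>Mt\<close> the two weights of Phi are the numbers t and q - t of
      branches of lengths c + 1 and c.\<close>
    also have "\<dots> = Phi r M ?S (real q)"
      unfolding Phi_def fl Let_def of_int_of_nat_eq Mt
      by (simp add: sum_list_replicate algebra_simps)
    finally show "(\<Sum>i<length ?ls. 1 / (1 - ?S * real (?ls ! i))) = 0" using S(2) by simp
  qed
  then show ?thesis by (simp add: AS_def)
qed

section \<open>The maximum over integer q\<close>

text \<open>On each side of the peak the integer nearest to it wins. The clamp \<open>max 1\<close>
  acts only for p < 1: then no positive integer lies left of the peak, and qm and qp are both
  1.\<close>

lemma Max_unimodal_nat:
  fixes f :: "real \<Rightarrow> real"
  assumes mono: "strict_mono_on {a..p} f" and anti: "strict_antimono_on {p..b} f"
    and qm: "qm = max 1 (nat \<lfloor>p\<rfloor>)" and qp: "qp = nat \<lceil>p\<rceil>"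
    and a: "0 < a" "a \<le> p" and ran: "a \<le> real qm" "real qm \<le> b" "a \<le> real qp" "real qp \<le> b"
  shows "Max {f (real q) | q. a \<le> real q \<and> real q \<le> b} = max (f (real qm)) (f (real qp))"
proof (rule Max_eqI)
  have "{q. a \<le> real q \<and> real q \<le> b} \<subseteq> {..nat \<lfloor>b\<rfloor>}" by (auto simp: le_nat_floor)
  then have "finite {q. a \<le> real q \<and> real q \<le> b}" using finite_subset by blast
  then show "finite {f (real q) | q. a \<le> real q \<and> real q \<le> b}"
    by (simp add: Setcompr_eq_image)
  show "max (f (real qm)) (f (real qp)) \<in> {f (real q) | q. a \<le> real q \<and> real q \<le> b}"
    using ran unfolding max_def by auto
next
  fix y assume "y \<in> {f (real q) | q. a \<le> real q \<and> real q \<le> b}"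
  then obtain q where y: "y = f (real q)" and q: "a \<le> real q" "real q \<le> b" by blast
  show "y \<le> max (f (real qm)) (f (real qp))"
  proof (cases "real q \<le> p")
    case True
    \<comment> \<open>A positive q \<le> p forces the floor of p to be at least 1, so here the clamp
      is inactive and qm lies on the increasing side.\<close>
    have "q \<ge> 1" using q(1) a(1) by (cases q) auto
    moreover have "q \<le> nat \<lfloor>p\<rfloor>" using True by (simp add: le_nat_floor)
    ultimately have "q \<le> qm" "real qm \<le> p"
      unfolding qm using a by (auto simp: max_def)
    then have "f (real q) \<le> f (real qm)"
      using q ran strict_mono_on_leD[OF mono, of "real q" "real qm"] by auto
    then show ?thesis by (simp add: y)
  next
    case False
    have "p \<le> real qp" unfolding qp using a by linarith
    moreover have "qp \<le> q" unfolding qp using False by (simp add: nat_le_iff ceiling_le_iff)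
    ultimately have "f (real q) \<le> f (real qp)"
      using q monotone_onD[OF anti, of "real qp" "real q"] by (cases "qp = q") auto
    then show ?thesis by (simp add: y)
  qed
qed

lemma half_ceiling_bounds:
  assumes "r \<ge> 1" "s = nat \<lceil>real r / 2\<rceil>"
  shows "s \<ge> 1" "s \<le> r" "r \<le> 2 * s" "2 * s \<le> r + 1"
proof -
  have "real s = of_int \<lceil>real r / 2\<rceil>" using assms by simp
  then have s: "real r / 2 \<le> real s" "real s < real r / 2 + 1" by linarith+
  then have "real r \<le> real (2 * s)" "real (2 * s) < real (r + 2)" by simp_all
  then have "r \<le> 2 * s" "2 * s < r + 2" by (simp_all only: of_nat_le_iff of_nat_less_iff)
  then show "s \<ge> 1" "s \<le> r" "r \<le> 2 * s" "2 * s \<le> r + 1" using assms(1) by linarith+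
qed

text \<open>Rounding M/s down must not fall below M/r. By 2 s \<le> r + 1 a remainder modulo s is at
  most s - 1 \<le> r - s, hence at most r - s copies of a positive quotient; if the quotient is 0,
  then M < s \<le> r and the clamped value 1 suffices.\<close>

lemma floor_ceiling_quotient_bounds:
  fixes r M s :: nat
  assumes "M \<ge> 1" "s \<ge> 1" "s \<le> r" "2 * s \<le> r + 1"
  shows "real M / real r \<le> real (max 1 (nat \<lfloor>real M / real s\<rfloor>))"
    "max 1 (nat \<lfloor>real M / real s\<rfloor>) \<le> M"
    "real M / real r \<le> real (nat \<lceil>real M / real s\<rceil>)"
    "nat \<lceil>real M / real s\<rceil> \<le> M"
proof -
  have fl: "nat \<lfloor>real M / real s\<rfloor> = M div s" by (simp add: floor_divide_of_nat_eq)
  have "M \<le> r * max 1 (M div s)"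
  proof (cases "M div s = 0")
    case True
    then show ?thesis using assms by (auto simp: div_eq_0_iff)
  next
    case False
    have "M mod s < s" using assms(2) by simp
    then have "M mod s \<le> r - s" using assms(3,4) by linarith
    also have "\<dots> \<le> (r - s) * (M div s)" using False by simp
    finally have "M \<le> M div s * s + (r - s) * (M div s)"
      using div_mult_mod_eq[of M s] by linarith
    also have "\<dots> = (s + (r - s)) * (M div s)" by (simp add: algebra_simps)
    also have "\<dots> = r * (M div s)" using assms(3) by simp
    finally show ?thesis using False by (simp add: max_def)
  qed
  then have "real M \<le> real r * real (max 1 (M div s))" by (simp only: flip: of_nat_mult of_nat_le_iff)
  then show "real M / real r \<le> real (max 1 (nat \<lfloor>real M / real s\<rfloor>))"
    unfolding fl using assms by (simp add: divide_le_eq mult.commute)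
  show "max 1 (nat \<lfloor>real M / real s\<rfloor>) \<le> M" unfolding fl using assms(1) by simp
  have "real M / real r \<le> real M / real s" using assms by (intro divide_left_mono) auto
  also have "\<dots> \<le> real (nat \<lceil>real M / real s\<rceil>)" by linarith
  finally show "real M / real r \<le> real (nat \<lceil>real M / real s\<rceil>)" .
  have "real M / real s \<le> real M / 1" using assms by (intro divide_left_mono) auto
  then show "nat \<lceil>real M / real s\<rceil> \<le> M" by (simp add: nat_le_iff ceiling_le_iff)
qed

theorem theorem2p6:
  fixes r M s :: nat
  assumes "r \<ge> 1" and "M \<ge> 1" and "s = nat \<lceil>real r / 2\<rceil>"
  shows "(\<forall>q\<in>{real M / real r .. real M}.
            \<exists>!lam. lam \<in> {1 / (real r + 1) <..< 1 / real r} \<and> Phi r M lam q = 0)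
    \<and> continuous_on {real M / real r .. real M} (Sigma_root r M)
    \<and> piecewise_C1 (real M / real r) (real M) (Sigma_root r M)
    \<and> strict_mono_on {real M / real r .. real M / real s} (Sigma_root r M)
    \<and> strict_antimono_on {real M / real s .. real M} (Sigma_root r M)
    \<and> (\<forall>qm cm tm qp cp tp :: nat.
         qm = max 1 (nat \<lfloor>real M / real s\<rfloor>) \<longrightarrow>
         qp = nat \<lceil>real M / real s\<rceil> \<longrightarrow>
         M = qm * cm + tm \<longrightarrow> tm < qm \<longrightarrow>
         M = qp * cp + tp \<longrightarrow> tp < qp \<longrightarrow>
         Max {steklov_lambda2 (AS r (q + 2) c t) | q c t :: nat.
                \<lceil>real M / real r\<rceil> \<le> int q \<and> q \<le> M \<and> M = q * c + t \<and> t < q}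
         = max (steklov_lambda2 (AS r (qm + 2) cm tm))
               (steklov_lambda2 (AS r (qp + 2) cp tp)))"
proof -
  note s = half_ceiling_bounds[OF assms(1,3)]
  have p: "real M / real r \<le> real M / real s"
    using s by (intro divide_left_mono) auto
  have mono: "strict_mono_on {real M / real r .. real M / real s} (Sigma_root r M)"
    using Sigma_root_strict_mono_on[OF assms(1,2) s(1-3)] .
  have anti: "strict_antimono_on {real M / real s .. real M} (Sigma_root r M)"
    using Sigma_root_strict_antimono_on[OF assms(1,2) s(1,2,4)] .
  note lam2 = steklov_lambda2_AS[OF assms(1,2)]
  have max: "Max {steklov_lambda2 (AS r (q + 2) c t) | q c t :: nat.
                \<lceil>real M / real r\<rceil> \<le> int q \<and> q \<le> M \<and> M = q * c + t \<and> t < q}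
         = max (steklov_lambda2 (AS r (qm + 2) cm tm)) (steklov_lambda2 (AS r (qp + 2) cp tp))"
    if q: "qm = max 1 (nat \<lfloor>real M / real s\<rfloor>)" "qp = nat \<lceil>real M / real s\<rceil>"
      "M = qm * cm + tm" "tm < qm" "M = qp * cp + tp" "tp < qp" for qm cm tm qp cp tp
  proof -
    have ran: "real M / real r \<le> real qm" "qm \<le> M" "real M / real r \<le> real qp" "qp \<le> M"
      unfolding q(1,2) using floor_ceiling_quotient_bounds[OF assms(2) s(1,2,4)] by auto
    have "{steklov_lambda2 (AS r (q + 2) c t) | q c t :: nat.
        \<lceil>real M / real r\<rceil> \<le> int q \<and> q \<le> M \<and> M = q * c + t \<and> t < q} =
      {Sigma_root r M (real q) | q. real M / real r \<le> real q \<and> real q \<le> real M}"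
      (is "?L = ?R")
    proof (intro equalityI subsetI)
      fix y assume "y \<in> ?L"
      then obtain q c t where y: "y = steklov_lambda2 (AS r (q + 2) c t)"
        and qct: "\<lceil>real M / real r\<rceil> \<le> int q" "q \<le> M" "M = q * c + t" "t < q"
        by blast
      have "real M / real r \<le> real q" using qct(1) by (simp add: ceiling_le_iff)
      then have "y = Sigma_root r M (real q)" "real M / real r \<le> real q" "real q \<le> real M"
        using lam2[OF _ qct(2-4)] qct(2) y by simp_all
      then show "y \<in> ?R" by blast
    next
      fix y assume "y \<in> ?R"
      then obtain q where y: "y = Sigma_root r M (real q)" "real M / real r \<le> real q" "q \<le> M" by auto
      have "0 < real M / real r" using assms by simp
      then have "0 < q" using y(2) by (cases q) auto
      \<comment> \<open>Division with remainder supplies the only admissible c and t, so each q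
        contributes exactly one value.\<close>
      then have m: "M = q * (M div q) + M mod q" "M mod q < q" by auto
      have "\<lceil>real M / real r\<rceil> \<le> int q" using y(2) by (simp add: ceiling_le_iff)
      moreover have "y = steklov_lambda2 (AS r (q + 2) (M div q) (M mod q))"
        using lam2[OF y(2,3) m] y(1) by simp
      ultimately show "y \<in> ?L" using y(3) m by blast
    qed
    also have "Max \<dots> = max (Sigma_root r M (real qm)) (Sigma_root r M (real qp))"
      using Max_unimodal_nat[OF mono anti q(1,2) _ p] ran assms by simp
    also have "Sigma_root r M (real qm) = steklov_lambda2 (AS r (qm + 2) cm tm)"
      using lam2[OF ran(1,2) q(3,4)] ..
    also have "Sigma_root r M (real qp) = steklov_lambda2 (AS r (qp + 2) cp tp)"
      using lam2[OF ran(3,4) q(5,6)] ..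
    finally show ?thesis .
  qed
  show ?thesis
    using Sigma_root_unique[OF assms(1,2)] Sigma_root_continuous_on[OF assms(1,2)]
      Sigma_root_piecewise_C1[OF assms(1,2)] mono anti max
    by (intro conjI ballI allI impI)
qed

end
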